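(* Let $R=(E,(\rho_i)_{i\in I})$ be a relational structure on an infinite set $E$, and suppose that $R$ admits a monomorphic decomposition into finitely many blocks $(E_i)_{i\in X}$ ($X$ a finite index set), exactly $k$ of which are infinite. Then the generating series $$\mathcal H_{\varphi_R}(Z)=\sum_{n\ge 0}\varphi_R(n)Z^n$$ is a rational fraction of the form $$\frac{P(Z)}{(1-Z)(1-Z^2)\cdots(1-Z^k)}$$ for some polynomial $P(Z)$. In particular, for $n$ large enough, $\varphi_R(n)$ is a quasi-polynomial in $n$ of degree at most $k-1$, i.e. $\varphi_R(n)=a_{k-1}(n)n^{k-1}+\dots+a_0(n)$ with periodic coefficient functions $a_j$.
   Context: A relational structure $R=(E,(\rho_i)_{i\in I})$ consists of a set $E$ and a family of relations $\rho_i\subseteq E^{n_i}$ ($n_i$ positive integers, $I$ possibly infinite). For $A\subseteq E$, the induced substructure is $R_{\restriction A}=(A,(\rho_i\cap A^{n_i})_{i\in I})$; two structures with the same index set are isomorphic if there is a bijection between their domains carrying each $\rho_i$ onto the corresponding relation. The profile of $R$ is the function $\varphi_R$ assigning to each integer $n\ge0$ the number of isomorphism classes of induced substructures $R_{\restriction A}$ with $A$ an $n$-element subset of $E$. A monomorphic decomposition of $R$ is a partition $\mathcal P$ of $E$ into blocks such that for every $n$, whenever $A,A'$ are $n$-element subsets of $E$ with $|A\cap B|=|A'\cap B|$ for every block $B\in\mathcal P$, the induced substructures $R_{\restriction A}$ and $R_{\restriction A'}$ are isomorphic. *)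

theory Defs
  imports
    "HOL-Library.NList"
    "HOL-Library.Disjoint_Sets"
    "HOL-Computational_Algebra.Polynomial_FPS"
begin

text \<open>
  A subset of the \<open>n\<close>-th Cartesian power of \<open>E\<close> is a subset of \<open>nlists n E\<close>. The default simp rules for
  \<open>nlists\<close> make the simplifier loop together with \<open>nlists_def\<close>.
\<close>

declare nlistsE_length [simp del] nlistsE_set [simp del]

record ('a, 'i) rel_structure =
  dom_of :: "'a set"
  index :: "'i set"
  arity :: "'i \<Rightarrow> nat"
  rel :: "'i \<Rightarrow> 'a list set"

definition rel_structure :: "('a, 'i) rel_structure \<Rightarrow> bool" where
  "rel_structure R \<longleftrightarrow>
     (\<forall>i\<in>index R. arity R i > 0 \<and> rel R i \<subseteq> nlists (arity R i) (dom_of R))"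

definition induced :: "('a, 'i) rel_structure \<Rightarrow> 'a set \<Rightarrow> ('a, 'i) rel_structure" where
  "induced R A =
     \<lparr>dom_of = A, index = index R, arity = arity R,
      rel = (\<lambda>i. rel R i \<inter> nlists (arity R i) A)\<rparr>"

definition isomorphic :: "('a, 'i) rel_structure \<Rightarrow> ('b, 'i) rel_structure \<Rightarrow> bool" where
  "isomorphic R S \<longleftrightarrow>
     index R = index S \<and> (\<forall>i\<in>index R. arity R i = arity S i) \<and>
     (\<exists>f. bij_betw f (dom_of R) (dom_of S) \<and> (\<forall>i\<in>index R. map f ` rel R i = rel S i))"

definition nsubsets :: "'a set \<Rightarrow> nat \<Rightarrow> 'a set set" where
  "nsubsets E n = {A. A \<subseteq> E \<and> finite A \<and> card A = n}"

definition iso_classes :: "('a, 'i) rel_structure \<Rightarrow> nat \<Rightarrow> 'a set set set" where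
  "iso_classes R n =
     nsubsets (dom_of R) n //
       {(A, B). A \<in> nsubsets (dom_of R) n \<and> B \<in> nsubsets (dom_of R) n \<and>
                isomorphic (induced R A) (induced R B)}"

text \<open>
  The value is the true number of classes only if there are finitely many of them. This holds as soon as
  \<open>R\<close> has a finite monomorphic decomposition: see \<open>finite_iso_classes\<close> below.
\<close>

definition profile :: "('a, 'i) rel_structure \<Rightarrow> nat \<Rightarrow> nat" where
  "profile R n = card (iso_classes R n)"

definition monomorphic_decomposition :: "('a, 'i) rel_structure \<Rightarrow> 'a set set \<Rightarrow> bool" where
  "monomorphic_decomposition R \<P> \<longleftrightarrow>
     partition_on (dom_of R) \<P> \<and>
     (\<forall>n. \<forall>A\<in>nsubsets (dom_of R) n. \<forall>A'\<in>nsubsets (dom_of R) n.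
        (\<forall>B\<in>\<P>. card (A \<inter> B) = card (A' \<inter> B)) \<longrightarrow>
        isomorphic (induced R A) (induced R A'))"

definition generating_series :: "(nat \<Rightarrow> nat) \<Rightarrow> rat fps" where
  "generating_series \<phi> = Abs_fps (\<lambda>n. of_nat (\<phi> n))"

definition periodic :: "(nat \<Rightarrow> 'b) \<Rightarrow> bool" where
  "periodic a \<longleftrightarrow> (\<exists>p>0. \<forall>n. a (n + p) = a n)"

text \<open>
  \<open>eventually_quasi_polynomial \<phi> k\<close>: from some point on, \<open>\<phi>\<close> agrees with a quasi-polynomial
  with coefficients in degrees \<open>0, \<dots>, k - 1\<close>, that is, of degree less than \<open>k\<close>.
\<close>

definition eventually_quasi_polynomial :: "(nat \<Rightarrow> nat) \<Rightarrow> nat \<Rightarrow> bool" where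
  "eventually_quasi_polynomial \<phi> k \<longleftrightarrow>
     (\<exists>a :: nat \<Rightarrow> nat \<Rightarrow> rat.
        (\<forall>j<k. periodic (a j)) \<and>
        (\<forall>\<^sub>F n in sequentially. of_nat (\<phi> n) = (\<Sum>j<k. a j n * of_nat n ^ j)))"

lemma isomorphic_induced_iff:
  "isomorphic (induced R A) (induced R B) \<longleftrightarrow>
     (\<exists>f. bij_betw f A B \<and>
        (\<forall>i\<in>index R. map f ` (rel R i \<inter> nlists (arity R i) A) = rel R i \<inter> nlists (arity R i) B))"
  by (simp add: isomorphic_def induced_def)

lemma isomorphic_sym:
  assumes iso: "isomorphic (induced R A) (induced R B)"
  shows "isomorphic (induced R B) (induced R A)"
proof -
  from iso obtain f where f: "bij_betw f A B"
    and r: "\<And>i. i \<in> index R \<Longrightarrow>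
      map f ` (rel R i \<inter> nlists (arity R i) A) = rel R i \<inter> nlists (arity R i) B"
    unfolding isomorphic_induced_iff by blast
  let ?g = "inv_into A f"
  have "map ?g ` (rel R i \<inter> nlists (arity R i) B) = rel R i \<inter> nlists (arity R i) A"
    if "i \<in> index R" for i
  proof -
    let ?X = "rel R i \<inter> nlists (arity R i) A"
    have "map ?g (map f xs) = xs" if "xs \<in> ?X" for xs
    proof -
      have "(?g \<circ> f) x = x" if "x \<in> set xs" for x
      proof -
        have "x \<in> A" using that \<open>xs \<in> ?X\<close> by (auto simp: nlists_def)
        then show ?thesis unfolding comp_apply by (rule bij_betw_inv_into_left[OF f])
      qed
      then show ?thesis unfolding map_map by (rule map_idI)
    qed
    then have "(\<lambda>xs. map ?g (map f xs)) ` ?X = (\<lambda>xs. xs) ` ?X"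
      by (rule image_cong[OF refl])
    then have "map ?g ` map f ` ?X = ?X"
      unfolding image_image image_ident .
    then show ?thesis by (simp only: r[OF that])
  qed
  with bij_betw_inv_into[OF f] show ?thesis
    unfolding isomorphic_induced_iff by blast
qed

lemma isomorphic_trans:
  assumes "isomorphic (induced R A) (induced R B)" "isomorphic (induced R B) (induced R C)"
  shows "isomorphic (induced R A) (induced R C)"
proof -
  from assms(1) obtain f where f: "bij_betw f A B"
    and rf: "\<And>i. i \<in> index R \<Longrightarrow>
      map f ` (rel R i \<inter> nlists (arity R i) A) = rel R i \<inter> nlists (arity R i) B"
    unfolding isomorphic_induced_iff by blast
  from assms(2) obtain g where g: "bij_betw g B C"
    and rg: "\<And>i. i \<in> index R \<Longrightarrow>
      map g ` (rel R i \<inter> nlists (arity R i) B) = rel R i \<inter> nlists (arity R i) C"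
    unfolding isomorphic_induced_iff by blast
  have "map (g \<circ> f) ` (rel R i \<inter> nlists (arity R i) A) = rel R i \<inter> nlists (arity R i) C"
    if "i \<in> index R" for i
  proof -
    have "map (g \<circ> f) ` X = map g ` map f ` X" for X by (simp add: image_image)
    then show ?thesis by (simp only: rf[OF that] rg[OF that])
  qed
  with bij_betw_trans[OF f g] show ?thesis
    unfolding isomorphic_induced_iff by blast
qed

lemma finite_iso_classes:
  assumes dec: "monomorphic_decomposition R \<P>" and fin: "finite \<P>"
  shows "finite (iso_classes R n)"
proof -
  let ?S = "nsubsets (dom_of R) n"
  let ?r = "{(A, B). A \<in> ?S \<and> B \<in> ?S \<and> isomorphic (induced R A) (induced R B)}"
  let ?c = "\<lambda>A. restrict (\<lambda>B. card (A \<inter> B)) \<P>"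
  have "?c ` ?S \<subseteq> \<P> \<rightarrow>\<^sub>E {..n}"
    by (auto simp: nsubsets_def intro: card_mono)
  then have fc: "finite (?c ` ?S)"
    by (rule finite_subset) (simp add: fin finite_PiE)
  have same: "?r `` {A} = ?r `` {A'}" if "A \<in> ?S" "A' \<in> ?S" "?c A = ?c A'" for A A'
  proof -
    have "card (A \<inter> B) = card (A' \<inter> B)" if "B \<in> \<P>" for B
      using fun_cong[OF \<open>?c A = ?c A'\<close>, of B] that by simp
    then have "isomorphic (induced R A) (induced R A')"
      using dec that(1,2) unfolding monomorphic_decomposition_def by blast
    then have "isomorphic (induced R A) (induced R B) \<longleftrightarrow> isomorphic (induced R A') (induced R B)" for B
      using isomorphic_sym isomorphic_trans by blast
    then show ?thesis
      using that(1,2) by simp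
  qed
  have "iso_classes R n \<subseteq> (\<lambda>c. ?r `` {inv_into ?S ?c c}) ` ?c ` ?S"
  proof
    fix K assume "K \<in> iso_classes R n"
    then obtain A where A: "A \<in> ?S" "K = ?r `` {A}"
      by (auto simp: iso_classes_def elim: quotientE)
    let ?A' = "inv_into ?S ?c (?c A)"
    have "?A' \<in> ?S"
      by (rule inv_into_into) (rule imageI[OF A(1)])
    moreover have "?c ?A' = ?c A"
      by (rule f_inv_into_f) (rule imageI[OF A(1)])
    ultimately have "K = ?r `` {?A'}"
      using same[OF A(1), of ?A'] A(2) by (simp only:)
    then show "K \<in> (\<lambda>c. ?r `` {inv_into ?S ?c c}) ` ?c ` ?S"
      using A(1) by blast
  qed
  then show ?thesis using fc by (meson finite_imageI finite_subset)
qed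

end

theory Submission
  imports Defs "HOL-Library.List_Lexorder"
begin

text \<open>
  Record a finite set \<open>A\<close> by the vector \<open>d x = card (A \<inter> x)\<close> over the blocks \<open>x\<close>; it determines
  \<open>A\<close> up to isomorphism. Each isomorphism class is represented by its vector maximizing
  \<open>\<Sum>x. K ^ d x\<close>, with \<open>K\<close> the number of blocks plus one, ties being broken lexicographically. The point is
  that if \<open>d\<close> represents a class, and \<open>S = {x. t \<le> d x}\<close> is a level set at a height \<open>t\<close> exceeding the
  sizes of all finite blocks, then \<open>d\<close> plus the indicator of \<open>S\<close> also represents a class.

  Split the representing vectors according to their part below a fixed height and their chain of
  higher level sets. Recording the multiplicities of the level sets identifies each of the finitely
  many pieces with an up-set of exponent vectors, where a level set \<open>S\<close> contributes \<open>card S\<close> to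
  the degree. By Dickson's lemma and inclusion-exclusion, the series of a piece has denominator
  \<open>\<Prod>S. 1 - X ^ card S\<close> over a chain of sets of infinite blocks, hence over sets of distinct sizes
  in \<open>{1..k}\<close>.
\<close>

unbundle fps_syntax

section \<open>Generating functions\<close>

text \<open>\<open>card\<close> would count an infinite slice as 0, whence the finiteness
  assumptions wherever a set is split into pieces.\<close>

definition gf :: "('w \<Rightarrow> nat) \<Rightarrow> 'w set \<Rightarrow> rat fps" where
  "gf deg W = Abs_fps (\<lambda>n. of_nat (card {w \<in> W. deg w = n}))"

lemma gf_cong: "(\<And>w. w \<in> W \<Longrightarrow> deg w = deg' w) \<Longrightarrow> gf deg W = gf deg' W"
  unfolding gf_def by (intro arg_cong[where f = Abs_fps] ext arg_cong[where f = of_nat]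
      arg_cong[where f = card]) auto

lemma gf_empty: "gf deg {} = 0"
  by (simp add: gf_def fps_zero_def)

lemma gf_Un:
  assumes "\<And>n. finite {w \<in> A \<union> B. deg w = n}"
  shows "gf deg (A \<union> B) = gf deg A + gf deg B - gf deg (A \<inter> B)"
proof (rule fps_ext)
  fix n
  let ?A = "{w \<in> A. deg w = n}" and ?B = "{w \<in> B. deg w = n}"
  have eq: "{w \<in> A \<union> B. deg w = n} = ?A \<union> ?B" "{w \<in> A \<inter> B. deg w = n} = ?A \<inter> ?B"
    by auto
  with assms[of n] have "finite ?A" "finite ?B" by auto
  from card_Un_Int[OF this]
  have "rat_of_nat (card ?A) + of_nat (card ?B) = of_nat (card (?A \<union> ?B)) + of_nat (card (?A \<inter> ?B))"
    by (simp only: of_nat_add[symmetric])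
  then show "gf deg (A \<union> B) $ n = (gf deg A + gf deg B - gf deg (A \<inter> B)) $ n"
    unfolding gf_def fps_nth_Abs_fps fps_add_nth fps_sub_nth eq by simp
qed

lemma gf_eq_sum_fibers:
  assumes "finite (p ` W)" "\<And>n. finite {w \<in> W. deg w = n}"
  shows "gf deg W = (\<Sum>q\<in>p ` W. gf deg {w \<in> W. p w = q})"
proof (rule fps_ext)
  fix n
  have "card {w \<in> W. deg w = n} = (\<Sum>q\<in>p ` W. \<Sum>w\<in>{w \<in> {w \<in> W. deg w = n}. p w = q}. 1)"
    by (subst sum.group) (use assms in auto)
  also have "\<dots> = (\<Sum>q\<in>p ` W. card {w \<in> {w \<in> W. p w = q}. deg w = n})"
    by (simp add: conj_ac)
  finally show "gf deg W $ n = (\<Sum>q\<in>p ` W. gf deg {w \<in> W. p w = q}) $ n"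
    by (simp add: gf_def fps_sum_nth)
qed

lemma gf_image:
  assumes "inj_on g W" and deg: "\<And>w. w \<in> W \<Longrightarrow> deg (g w) = c + deg' w"
  shows "gf deg (g ` W) = fps_X ^ c * gf deg' W"
proof (rule fps_ext)
  fix n
  have "card {v \<in> g ` W. deg v = n} = (if n < c then 0 else card {w \<in> W. deg' w = n - c})"
  proof (cases "n < c")
    case True
    then have eq: "{v \<in> g ` W. deg v = n} = {}" using deg by auto
    show ?thesis unfolding eq using True by simp
  next
    case False
    then have "{v \<in> g ` W. deg v = n} = g ` {w \<in> W. deg' w = n - c}" using deg by auto
    moreover have "inj_on g {w \<in> W. deg' w = n - c}"
      using assms(1) by (rule inj_on_subset) auto
    ultimately show ?thesis using False by (simp add: card_image)
  qed
  then show "gf deg (g ` W) $ n = (fps_X ^ c * gf deg' W) $ n"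
    by (simp add: gf_def fps_X_power_mult_nth)
qed

text \<open>Being a polynomial is expressed as membership in \<open>range fps_of_poly\<close>, so
  that closure under ring operations applies without naming polynomials.\<close>

lemma fps_of_poly_range_intros:
  fixes F G :: "'a::comm_ring_1 fps"
  shows "F \<in> range fps_of_poly \<Longrightarrow> G \<in> range fps_of_poly \<Longrightarrow> F + G \<in> range fps_of_poly"
    and "F \<in> range fps_of_poly \<Longrightarrow> G \<in> range fps_of_poly \<Longrightarrow> F - G \<in> range fps_of_poly"
    and "F \<in> range fps_of_poly \<Longrightarrow> G \<in> range fps_of_poly \<Longrightarrow> F * G \<in> range fps_of_poly"
    and "1 \<in> range (fps_of_poly :: 'a poly \<Rightarrow> _)"
    and "fps_X \<in> range (fps_of_poly :: 'a poly \<Rightarrow> _)"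
    and "F \<in> range fps_of_poly \<Longrightarrow> F ^ n \<in> range fps_of_poly"
  subgoal by (elim rangeE) (simp only: fps_of_poly_add[symmetric] rangeI)
  subgoal by (elim rangeE) (simp only: fps_of_poly_diff[symmetric] rangeI)
  subgoal by (elim rangeE) (simp only: fps_of_poly_mult[symmetric] rangeI)
  subgoal using rangeI[of fps_of_poly 1] by simp
  subgoal using rangeI[of fps_of_poly "[:0, 1:]"] by (simp add: fps_of_poly_fps_X)
  subgoal by (elim rangeE) (simp only: fps_of_poly_power[symmetric] rangeI)
  done

lemma fps_of_poly_range_sum:
  "(\<And>i. i \<in> I \<Longrightarrow> F i \<in> range fps_of_poly) \<Longrightarrow> sum F I \<in> range fps_of_poly"
  for F :: "'b \<Rightarrow> 'a::comm_ring_1 fps"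
proof (induction I rule: infinite_finite_induct)
  case (infinite I) then show ?case using rangeI[of fps_of_poly 0] by simp
next
  case empty then show ?case using rangeI[of fps_of_poly 0] by simp
next
  case (insert i I) then show ?case by (simp add: fps_of_poly_range_intros)
qed

lemma fps_of_poly_range_prod:
  "(\<And>i. i \<in> I \<Longrightarrow> F i \<in> range fps_of_poly) \<Longrightarrow> prod F I \<in> range fps_of_poly"
  for F :: "'b \<Rightarrow> 'a::comm_ring_1 fps"
  by (induction I rule: infinite_finite_induct) (simp_all add: fps_of_poly_range_intros(3,4))

section \<open>Up-sets of exponent vectors\<close>

text \<open>A monotone subsequence exists. A decreasing one reaches its minimum at some index
  \<open>N\<close> and is constant from there on.\<close>

lemma incseq_subseq_nat:
  fixes f :: "nat \<Rightarrow> nat"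
  shows "\<exists>r. strict_mono (r :: nat \<Rightarrow> nat) \<and> incseq (f \<circ> r)"
proof -
  obtain r where r: "strict_mono (r :: nat \<Rightarrow> nat)" "monoseq (\<lambda>n. f (r n))"
    using seq_monosub[of f] by blast
  show ?thesis
  proof (cases "incseq (\<lambda>n. f (r n))")
    case True with r(1) show ?thesis by (auto simp: comp_def)
  next
    case False
    with r(2) have dec: "decseq (\<lambda>n. f (r n))" by (simp add: monoseq_iff)
    define N where "N = (ARG_MIN (\<lambda>n. f (r n)) n. True)"
    have min: "f (r N) \<le> f (r n)" for n
      unfolding N_def by (rule arg_min_nat_le) simp
    have "f (r (N + n)) = f (r N)" for n
      using min[of "N + n"] decseqD[OF dec, of N "N + n"] by simp
    then have "incseq (f \<circ> (\<lambda>n. r (N + n)))" by (simp add: comp_def)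
    moreover have "strict_mono (\<lambda>n. r (N + n))"
      using r(1) by (simp add: strict_mono_def)
    ultimately show ?thesis by blast
  qed
qed

lemma incseq_subseq_fun:
  fixes f :: "nat \<Rightarrow> 's \<Rightarrow> nat"
  assumes "finite J"
  shows "\<exists>r. strict_mono (r :: nat \<Rightarrow> nat) \<and> (\<forall>s\<in>J. incseq (\<lambda>n. f (r n) s))"
  using assms
proof induction
  case empty
  show ?case by (rule exI[of _ id]) (simp add: strict_mono_def)
next
  case (insert s J)
  then obtain r where r: "strict_mono (r :: nat \<Rightarrow> nat)" "\<forall>s\<in>J. incseq (\<lambda>n. f (r n) s)"
    by blast
  obtain q where q: "strict_mono (q :: nat \<Rightarrow> nat)" "incseq ((\<lambda>n. f (r n) s) \<circ> q)"
    using incseq_subseq_nat by blast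
  have "incseq (\<lambda>n. f (r (q n)) s')" if "s' \<in> J" for s'
    using r(2) that q(1) by (auto simp: incseq_def strict_mono_less_eq)
  then show ?case
    using strict_mono_o[OF r(1) q(1)] q(2) by (intro exI[of _ "r \<circ> q"]) (auto simp: comp_def)
qed

text \<open>Vectors are total functions vanishing outside \<open>J\<close>, so that equality and the
  pointwise order of functions are those of vectors.\<close>

abbreviation vecs :: "'s set \<Rightarrow> ('s \<Rightarrow> nat) set" where
  "vecs J \<equiv> {w. \<forall>s. s \<notin> J \<longrightarrow> w s = 0}"

abbreviation up :: "'s set \<Rightarrow> ('s \<Rightarrow> nat) \<Rightarrow> ('s \<Rightarrow> nat) set" where
  "up J u \<equiv> {w \<in> vecs J. u \<le> w}"

text \<open>\<open>M\<close> consists of the minimal elements of \<open>U\<close>. Were it infinite,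
  a sequence of distinct ones would have a pointwise increasing subsequence, so two of them would be
  comparable. Descent on the coordinate sum finds a minimal element below each
  \<open>w\<close>.\<close>

lemma dickson:
  assumes fin: "finite J" and U: "U \<subseteq> vecs J"
  shows "\<exists>M\<subseteq>U. finite M \<and> (\<forall>w\<in>U. \<exists>u\<in>M. u \<le> w)"
proof (intro exI[of _ "{u \<in> U. \<forall>v\<in>U. v \<le> u \<longrightarrow> v = u}"] conjI ballI)
  let ?M = "{u \<in> U. \<forall>v\<in>U. v \<le> u \<longrightarrow> v = u}"
  show "?M \<subseteq> U" by blast
  show "finite ?M"
  proof (rule ccontr)
    assume "infinite ?M"
    then obtain f :: "nat \<Rightarrow> _" where f: "inj f" "range f \<subseteq> ?M"
      using infinite_countable_subset by blast
    obtain r where r: "strict_mono (r :: nat \<Rightarrow> nat)" "\<forall>s\<in>J. incseq (\<lambda>n. f (r n) s)"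
      using incseq_subseq_fun[OF fin] by blast
    have "f n \<in> ?M" for n using f(2) by blast
    note this [simplified]
    note M = this[THEN conjunct1] this[THEN conjunct2]
    have "f (r 0) \<le> f (r 1)"
    proof (rule le_funI)
      fix s show "f (r 0) s \<le> f (r 1) s"
      proof (cases "s \<in> J")
        case True then show ?thesis using r(2) by (auto simp: incseq_def)
      next
        case False then show ?thesis using M(1)[of "r 0"] U by auto
      qed
    qed
    then have "f (r 0) = f (r 1)" using M(1)[of "r 0"] M(2)[of "r 1"] by simp
    then have "r 0 = r 1" using f(1) by (simp add: inj_eq)
    then show False using r(1) by (simp add: strict_mono_eq)
  qed
  fix w assume "w \<in> U"
  then show "\<exists>u\<in>?M. u \<le> w"
  proof (induction "sum w J" arbitrary: w rule: less_induct)
    case less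
    show ?case
    proof (cases "w \<in> ?M")
      case False
      then obtain v where v: "v \<in> U" "v \<le> w" "v \<noteq> w" using less.prems by blast
      then obtain s where s: "v s \<noteq> w s" by blast
      have "s \<in> J"
      proof (rule ccontr)
        assume "s \<notin> J"
        with U v(1) less.prems have "v s = 0" "w s = 0" by auto
        with s show False by simp
      qed
      then have "sum v J < sum w J"
        using s le_funD[OF v(2)] fin by (intro sum_strict_mono_ex1) (auto simp: order.strict_iff_order)
      from less.hyps[OF this v(1)] obtain u where u: "u \<in> ?M" "u \<le> v" by (rule bexE)
      show ?thesis by (rule bexI[of _ u]) (use order_trans[OF u(2) v(2)] u(1) in simp_all)
    qed blast
  qed
qed

section \<open>Generating functions of up-sets\<close>

lemma finite_wdeg_slice:
  fixes m :: "'s \<Rightarrow> nat"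
  assumes "finite J" "\<And>s. s \<in> J \<Longrightarrow> m s > 0"
  shows "finite {w \<in> vecs J. (\<Sum>s\<in>J. m s * w s) = n}"
proof (rule finite_subset)
  show "finite {w. \<forall>s. (s \<in> J \<longrightarrow> w s \<in> {..n}) \<and> (s \<notin> J \<longrightarrow> w s = 0)}"
    by (rule finite_set_of_finite_funs) (use assms in auto)
  have "w s \<le> (\<Sum>s\<in>J. m s * w s)" if s: "s \<in> J" for w s
  proof -
    have "w s \<le> m s * w s" using assms(2)[OF s] by simp
    also have "\<dots> \<le> (\<Sum>s\<in>J. m s * w s)" using assms(1) s by (intro member_le_sum) auto
    finally show ?thesis .
  qed
  then show "{w \<in> vecs J. (\<Sum>s\<in>J. m s * w s) = n}
    \<subseteq> {w. \<forall>s. (s \<in> J \<longrightarrow> w s \<in> {..n}) \<and> (s \<notin> J \<longrightarrow> w s = 0)}"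
    by auto
qed

text \<open>A product of geometric series. A vector on \<open>insert s J\<close> either vanishes at
  \<open>s\<close> or is an increment at \<open>s\<close> of another one, so its series is that of
  \<open>J\<close> plus \<open>fps_X ^ m s\<close> times itself.\<close>

lemma gf_vecs:
  fixes m :: "'s \<Rightarrow> nat"
  assumes "finite J" "\<And>s. s \<in> J \<Longrightarrow> m s > 0"
  shows "gf (\<lambda>w. \<Sum>s\<in>J. m s * w s) (vecs J) * (\<Prod>s\<in>J. 1 - fps_X ^ m s) = 1"
  using assms
proof (induction J)
  case empty
  have "{w \<in> vecs {}. (\<Sum>s\<in>{}. m s * w s) = n} = (if n = 0 then {\<lambda>_. 0} else {})" for n
    by auto
  then have "gf (\<lambda>w. \<Sum>s\<in>{}. m s * w s) (vecs {}) = Abs_fps (\<lambda>n. if n = 0 then 1 else 0)"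
    unfolding gf_def by (intro arg_cong[where f = Abs_fps] ext) simp
  then show ?case by (simp add: fps_one_def)
next
  case (insert s J)
  let ?d = "\<lambda>w. \<Sum>s\<in>insert s J. m s * w s"
  let ?g = "\<lambda>w :: 's \<Rightarrow> nat. w(s := Suc (w s))"
  have deg: "?d w = m s * w s + (\<Sum>s\<in>J. m s * w s)" for w
    using insert.hyps by simp
  have split: "vecs (insert s J) = vecs J \<union> ?g ` vecs (insert s J)"
  proof (intro equalityI subsetI)
    fix w :: "'s \<Rightarrow> nat" assume w: "w \<in> vecs (insert s J)"
    show "w \<in> vecs J \<union> ?g ` vecs (insert s J)"
    proof (cases "w s = 0")
      case True
      then have "w s' = 0" if "s' \<notin> J" for s' using w that by (cases "s' = s") auto
      then show ?thesis by simp
    next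
      case False
      then have "w = ?g (w(s := w s - 1))" by auto
      moreover have "w(s := w s - 1) \<in> vecs (insert s J)" using w by auto
      ultimately show ?thesis by blast
    qed
  qed auto
  have disj: "vecs J \<inter> ?g ` vecs (insert s J) = {}"
    using insert.hyps by auto
  have inj: "inj_on ?g W" for W
    by (rule inj_onI) (metis (no_types, lifting) fun_upd_apply fun_upd_triv fun_upd_upd nat.inject)
  have gs: "?d (?g w) = m s + ?d w" for w
  proof -
    have "(\<Sum>s\<in>J. m s * ?g w s) = (\<Sum>s\<in>J. m s * w s)"
      using insert.hyps by (intro sum.cong) auto
    then show ?thesis unfolding deg by simp
  qed
  have fin: "finite {w \<in> vecs J \<union> ?g ` vecs (insert s J). ?d w = n}" for n
    unfolding split[symmetric] by (rule finite_wdeg_slice) (use insert in auto)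
  have "gf ?d (vecs (insert s J)) = gf ?d (vecs J \<union> ?g ` vecs (insert s J))"
    using split by (rule arg_cong)
  also have "\<dots> = gf ?d (vecs J) + gf ?d (?g ` vecs (insert s J))"
    unfolding gf_Un[OF fin] disj gf_empty by simp
  also have "gf ?d (vecs J) = gf (\<lambda>w. \<Sum>s\<in>J. m s * w s) (vecs J)"
    by (rule gf_cong) (use insert.hyps in simp)
  also have "gf ?d (?g ` vecs (insert s J)) = fps_X ^ m s * gf ?d (vecs (insert s J))"
    by (rule gf_image[OF inj]) (rule gs)
  finally have "gf ?d (vecs (insert s J)) * (1 - fps_X ^ m s) = gf (\<lambda>w. \<Sum>s\<in>J. m s * w s) (vecs J)"
    by (simp add: algebra_simps)
  then show ?case
    using insert.IH insert.prems insert.hyps by (simp add: mult.assoc[symmetric])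
qed

lemma gf_up:
  fixes m :: "'s \<Rightarrow> nat"
  assumes "finite J" "\<And>s. s \<in> J \<Longrightarrow> m s > 0" and u: "u \<in> vecs J"
  shows "gf (\<lambda>w. \<Sum>s\<in>J. m s * w s) (up J u) * (\<Prod>s\<in>J. 1 - fps_X ^ m s) \<in> range fps_of_poly"
proof -
  have "up J u = (\<lambda>w s. u s + w s) ` vecs J"
  proof (intro equalityI subsetI)
    fix w assume w: "w \<in> up J u"
    then have "w = (\<lambda>s. u s + (w s - u s))" by (auto simp: le_fun_def)
    moreover have "(\<lambda>s. w s - u s) \<in> vecs J" using w by auto
    ultimately show "w \<in> (\<lambda>w s. u s + w s) ` vecs J" by (rule image_eqI)
  next
    fix w assume "w \<in> (\<lambda>w s. u s + w s) ` vecs J"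
    then show "w \<in> up J u" using u by (auto simp: le_fun_def)
  qed
  moreover have "inj_on (\<lambda>w s. u s + w s) (vecs J)"
    by (rule inj_onI) (simp add: fun_eq_iff)
  ultimately have "gf (\<lambda>w. \<Sum>s\<in>J. m s * w s) (up J u)
      = fps_X ^ (\<Sum>s\<in>J. m s * u s) * gf (\<lambda>w. \<Sum>s\<in>J. m s * w s) (vecs J)"
    using gf_image[of "\<lambda>w s. u s + w s" "vecs J" "\<lambda>w. \<Sum>s\<in>J. m s * w s"]
    by (simp add: algebra_simps sum.distrib)
  then have "gf (\<lambda>w. \<Sum>s\<in>J. m s * w s) (up J u) * (\<Prod>s\<in>J. 1 - fps_X ^ m s) = fps_X ^ (\<Sum>s\<in>J. m s * u s)"
    using gf_vecs[OF assms(1,2)] by (simp add: mult.assoc)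
  then show ?thesis by (simp only: fps_of_poly_range_intros(5,6))
qed

text \<open>Inclusion-exclusion: \<open>up J u\<close> and \<open>up J v\<close> meet in
  \<open>up J (sup u v)\<close>, so splitting off one cone leaves two unions of fewer cones. The
  induction is on \<open>card M\<close>, as the suprema need not lie in \<open>M\<close>.\<close>

lemma gf_Union_up:
  fixes m :: "'s \<Rightarrow> nat"
  assumes J: "finite J" "\<And>s. s \<in> J \<Longrightarrow> m s > 0" and "finite M" "M \<subseteq> vecs J"
  shows "gf (\<lambda>w. \<Sum>s\<in>J. m s * w s) (\<Union>u\<in>M. up J u) * (\<Prod>s\<in>J. 1 - fps_X ^ m s)
    \<in> range fps_of_poly"
  using assms(3,4)
proof (induction "card M" arbitrary: M rule: less_induct)
  case less
  let ?d = "\<lambda>w. \<Sum>s\<in>J. m s * w s"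
  show ?case
  proof (cases "M = {}")
    case True
    then show ?thesis using rangeI[of fps_of_poly 0] by (simp add: gf_empty)
  next
    case False
    then obtain u M' where M: "M = insert u M'" "u \<notin> M'" by (meson Set.set_insert all_not_in_conv)
    with less.prems have fin: "finite M'" "card M' < card M" and sub: "M' \<subseteq> vecs J" "u \<in> vecs J"
      by auto
    let ?U = "\<Union>v\<in>M'. up J v"
    have int: "up J u \<inter> ?U = (\<Union>v\<in>sup u ` M'. up J v)" by auto
    have "finite {w \<in> up J u \<union> ?U. ?d w = n}" for n
      by (rule finite_subset[OF _ finite_wdeg_slice[OF J, where n = n]]) auto
    then have eq: "gf ?d (\<Union>u\<in>M. up J u) = gf ?d (up J u) + gf ?d ?U - gf ?d (\<Union>v\<in>sup u ` M'. up J v)"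
      using gf_Un[of "up J u" ?U ?d] by (simp only: M(1) UN_insert int)
    have "card (sup u ` M') < card M" using fin card_image_le[of M' "sup u"] by linarith
    moreover have "sup u ` M' \<subseteq> vecs J" using sub by auto
    ultimately have "gf ?d (\<Union>v\<in>sup u ` M'. up J v) * (\<Prod>s\<in>J. 1 - fps_X ^ m s) \<in> range fps_of_poly"
      using less.hyps fin by blast
    moreover have "gf ?d ?U * (\<Prod>s\<in>J. 1 - fps_X ^ m s) \<in> range fps_of_poly"
      using less.hyps fin sub by blast
    moreover have "gf ?d (up J u) * (\<Prod>s\<in>J. 1 - fps_X ^ m s) \<in> range fps_of_poly"
      using gf_up[OF J sub(2)] .
    ultimately show ?thesis
      unfolding eq ring_distribs by (intro fps_of_poly_range_intros(1,2))
  qed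
qed

text \<open>Closure under unit increments gives upward closure, so by Dickson's lemma
  \<open>U\<close> is a finite union of cones.\<close>

lemma gf_upset:
  fixes m :: "'s \<Rightarrow> nat"
  assumes J: "finite J" "\<And>s. s \<in> J \<Longrightarrow> m s > 0"
    and U: "U \<subseteq> vecs J" and closed: "\<And>w s. w \<in> U \<Longrightarrow> s \<in> J \<Longrightarrow> w(s := Suc (w s)) \<in> U"
  shows "gf (\<lambda>w. \<Sum>s\<in>J. m s * w s) U * (\<Prod>s\<in>J. 1 - fps_X ^ m s) \<in> range fps_of_poly"
proof -
  obtain M where M: "M \<subseteq> U" "finite M" "\<And>w. w \<in> U \<Longrightarrow> \<exists>u\<in>M. u \<le> w"
    using dickson[OF J(1) U] by blast
  have up: "w \<in> U" if "u \<in> U" "u \<le> w" "w \<in> vecs J" for u w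
    using that
  proof (induction "sum (\<lambda>s. w s - u s) J" arbitrary: u rule: less_induct)
    case less
    show ?case
    proof (cases "u = w")
      case False
      then obtain s where s: "u s \<noteq> w s" by blast
      with le_funD[OF less.prems(2), of s] have lt: "u s < w s" by simp
      with less.prems(3) have "s \<in> J" by fastforce
      let ?u = "u(s := Suc (u s))"
      have "sum (\<lambda>s. w s - ?u s) J < sum (\<lambda>s. w s - u s) J"
        using lt \<open>s \<in> J\<close> J(1) by (intro sum_strict_mono_ex1) auto
      moreover have "?u \<le> w" using less.prems(2) lt by (simp add: le_fun_def)
      ultimately show ?thesis
        using less.hyps closed[OF less.prems(1) \<open>s \<in> J\<close>] less.prems(3) by blast
    qed (use less.prems in simp)
  qed
  have "U = (\<Union>u\<in>M. up J u)"
  proof (intro equalityI subsetI)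
    fix w assume "w \<in> U"
    then show "w \<in> (\<Union>u\<in>M. up J u)" using M(3)[of w] U by blast
  next
    fix w assume "w \<in> (\<Union>u\<in>M. up J u)"
    then show "w \<in> U" using up M(1) by blast
  qed
  with gf_Union_up[OF J M(2)] M(1) U show ?thesis by (simp only: subset_trans)
qed

section \<open>Families closed under repeating a layer\<close>

text \<open>View \<open>d\<close> as a diagram whose row at height \<open>t\<close> is the level set
  \<open>{x. t \<le> d x}\<close>. Layers are the distinct nonempty rows from height
  \<open>T\<close> on, \<open>layer_count\<close> gives their multiplicities, and
  \<open>repeat_layer t\<close> inserts a second copy of row \<open>t\<close>.\<close>

definition layers :: "nat \<Rightarrow> ('x \<Rightarrow> nat) \<Rightarrow> 'x set set" where
  "layers T d = (\<lambda>t. {x. t \<le> d x}) ` {T..} - {{}}"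

definition layer_count :: "nat \<Rightarrow> ('x \<Rightarrow> nat) \<Rightarrow> 'x set \<Rightarrow> nat" where
  "layer_count T d S = (if S = {} then 0 else card {t. T \<le> t \<and> {x. t \<le> d x} = S})"

definition repeat_layer :: "nat \<Rightarrow> ('x \<Rightarrow> nat) \<Rightarrow> 'x \<Rightarrow> nat" where
  "repeat_layer t d = (\<lambda>x. if t \<le> d x then Suc (d x) else d x)"

lemma layers_subset: "S \<in> layers T d \<Longrightarrow> S \<subseteq> {x. T \<le> d x}"
  by (auto simp: layers_def)

lemma layers_Pow: "{x. T \<le> d x} \<subseteq> I \<Longrightarrow> layers T d \<subseteq> Pow I - {{}}"
proof
  fix S assume I: "{x. T \<le> d x} \<subseteq> I" and S: "S \<in> layers T d"
  then have "S \<noteq> {}" by (simp add: layers_def)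
  with subset_trans[OF layers_subset[OF S] I] show "S \<in> Pow I - {{}}" by simp
qed

lemma finite_layers: "finite {x. T \<le> d x} \<Longrightarrow> finite (layers T d)"
  using layers_Pow[OF order_refl, of T d] by (auto intro: finite_subset)

lemma finite_layer_times: "S \<noteq> {} \<Longrightarrow> finite {t. (T::nat) \<le> t \<and> {x. t \<le> d x} = S}"
proof -
  assume "S \<noteq> {}"
  then obtain x where "x \<in> S" by blast
  then have "{t. T \<le> t \<and> {x. t \<le> d x} = S} \<subseteq> {..d x}" by auto
  then show ?thesis by (rule finite_subset) (rule finite_atMost)
qed

lemma layer_count_vecs: "layer_count T d \<in> vecs (layers T d)"
proof -
  have "layer_count T d S = 0" if "S \<notin> layers T d" for S
  proof (cases "S = {}")
    case False
    with that have "{t. T \<le> t \<and> {x. t \<le> d x} = S} = {}" by (auto simp: layers_def)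
    then show ?thesis by (simp only: layer_count_def card.empty if_cancel)
  qed (simp add: layer_count_def)
  then show ?thesis by simp
qed

text \<open>Column \<open>x\<close> meets the rows from 1 to \<open>d x\<close>. Those below
  \<open>T\<close> account for \<open>min (d x) (T - 1)\<close>; the others are grouped by level
  set. Thus the part below \<open>T\<close>, the layers and their counts determine
  \<open>d\<close>.\<close>

lemma sum_layer_count:
  assumes "finite {x. T \<le> d x}" and T: "T > 0"
  shows "d x = min (d x) (T - 1) + (\<Sum>S\<in>layers T d. if x \<in> S then layer_count T d S else 0)"
proof -
  let ?t = "\<lambda>S. {t. (T::nat) \<le> t \<and> {x. t \<le> d x} = S}"
  let ?C = "{S \<in> layers T d. x \<in> S}"
  have "(\<Sum>S\<in>layers T d. if x \<in> S then layer_count T d S else 0) = (\<Sum>S\<in>?C. layer_count T d S)"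
    using finite_layers[OF assms(1)] by (simp add: sum.inter_filter)
  also have "\<dots> = (\<Sum>S\<in>?C. card (?t S))"
    by (rule sum.cong) (auto simp: layer_count_def)
  also have "\<dots> = card (\<Union>S\<in>?C. ?t S)"
  proof (rule card_UN_disjoint[symmetric])
    show "finite ?C" using finite_layers[OF assms(1)] by simp
    show "\<forall>S\<in>?C. finite (?t S)" by (intro ballI finite_layer_times) auto
  qed auto
  also have "(\<Union>S\<in>?C. ?t S) = {T..d x}"
    by (auto simp: layers_def)
  finally show ?thesis using T by (auto simp: min_def)
qed

lemma level_set_repeat_layer:
  "{x. u \<le> repeat_layer t d x} = {x. (if u \<le> t then u else u - 1) \<le> d x}"
  by (auto simp: repeat_layer_def)

lemma layers_repeat_layer:
  assumes "T \<le> t"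
  shows "layers T (repeat_layer t d) = layers T d"
proof -
  have "(\<lambda>u. {x. u \<le> repeat_layer t d x}) ` {T..}
      = (\<lambda>u. {x. u \<le> d x}) ` (\<lambda>u. if u \<le> t then u else u - 1) ` {T..}"
    unfolding level_set_repeat_layer image_image ..
  also have "(\<lambda>u. if u \<le> t then u else u - 1) ` {T..} = {T..}"
  proof (intro equalityI subsetI)
    fix u assume u: "u \<in> {T..}"
    show "u \<in> (\<lambda>u. if u \<le> t then u else u - 1) ` {T..}"
      by (rule image_eqI[of _ _ "if u \<le> t then u else Suc u"]) (use u in auto)
  qed (use assms in \<open>auto split: if_splits\<close>)
  finally show ?thesis unfolding layers_def by simp
qed

lemma layer_count_repeat_layer:
  assumes t: "T \<le> t" "{x. t \<le> d x} = S" "S \<noteq> {}"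
  shows "layer_count T (repeat_layer t d) = (layer_count T d)(S := Suc (layer_count T d S))"
proof
  fix S'
  show "layer_count T (repeat_layer t d) S' = ((layer_count T d)(S := Suc (layer_count T d S))) S'"
  proof (cases "S' = {}")
    case True
    with t(3) show ?thesis by (auto simp: layer_count_def)
  next
    case False
    \<comment> \<open>Before the repetition, \<open>S'\<close> is the row at the heights in
      \<open>A\<close>, below \<open>t\<close>, and in \<open>B\<close>, from \<open>t\<close> on.
      Afterwards \<open>B\<close> is shifted up by one, and \<open>D\<close> accounts for the row
      kept at height \<open>t\<close>, which is \<open>S\<close>.\<close>
    define A where "A = {u. T \<le> u \<and> u < t \<and> {x. u \<le> d x} = S'}"
    define B where "B = {u. t \<le> u \<and> {x. u \<le> d x} = S'}"
    define D where "D = (if S' = S then {t} else {})"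
    have less: "u < t" if "u \<in> A" for u using that by (simp add: A_def)
    have ge: "t \<le> u" if "u \<in> B" for u using that by (simp add: B_def)
    have eq: "u = t" if "u \<in> D" for u using that by (simp add: D_def split: if_splits)
    have old: "{u. T \<le> u \<and> {x. u \<le> d x} = S'} = A \<union> B"
      unfolding A_def B_def using t(1) by auto
    have new: "{u. T \<le> u \<and> {x. u \<le> repeat_layer t d x} = S'} = (A \<union> D) \<union> Suc ` B"
    proof (intro equalityI subsetI)
      fix u assume u: "u \<in> {u. T \<le> u \<and> {x. u \<le> repeat_layer t d x} = S'}"
      consider "u < t" | "u = t" | "t < u" by linarith
      then show "u \<in> (A \<union> D) \<union> Suc ` B"
      proof cases
        case 3
        with u have "u = Suc (u - 1)" "u - 1 \<in> B" by (auto simp: level_set_repeat_layer B_def)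
        then show ?thesis by blast
      qed (use u t in \<open>auto simp: level_set_repeat_layer A_def D_def\<close>)
    next
      fix u assume "u \<in> (A \<union> D) \<union> Suc ` B"
      then consider "u \<in> A" | "u \<in> D" | v where "u = Suc v" "v \<in> B" by blast
      then show "u \<in> {u. T \<le> u \<and> {x. u \<le> repeat_layer t d x} = S'}"
      proof cases
        case 2
        then have "u = t" "S' = S" by (simp_all add: D_def split: if_splits)
        with t show ?thesis by (simp add: level_set_repeat_layer)
      qed (use t in \<open>auto simp: level_set_repeat_layer A_def B_def\<close>)
    qed
    have fin: "finite (A \<union> B)"
      unfolding old[symmetric] using False by (rule finite_layer_times)
    have "(A \<union> D) \<inter> Suc ` B = {}" "A \<inter> D = {}" "A \<inter> B = {}"
      by (fastforce dest: less ge eq)+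
    moreover have "finite D" by (simp add: D_def)
    ultimately have "card ((A \<union> D) \<union> Suc ` B) = card A + card D + card (Suc ` B)"
      "card (A \<union> B) = card A + card B"
      using fin by (simp_all only: card_Un_disjoint finite_Un finite_imageI)
    moreover have "card (Suc ` B) = card B" by (rule card_image) simp
    ultimately have "layer_count T (repeat_layer t d) S' = card A + card D + card B"
      "layer_count T d S' = card A + card B"
      using False by (simp_all add: layer_count_def new old)
    then show ?thesis by (cases "S' = S") (simp_all add: D_def)
  qed
qed

text \<open>Double counting: a row equal to \<open>S\<close> has \<open>card S\<close> cells. The
  coordinate sum becomes a weighted degree of the layer counts, up to the contribution of the rows
  below \<open>T\<close>.\<close>

lemma sum_eq_sum_layer_count:
  assumes "finite X" "{x. T \<le> d x} \<subseteq> X" "T > 0"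
  shows "(\<Sum>x\<in>X. d x) = (\<Sum>x\<in>X. min (d x) (T - 1)) + (\<Sum>S\<in>layers T d. card S * layer_count T d S)"
proof -
  have fin: "finite {x. T \<le> d x}" using assms finite_subset by blast
  have "(\<Sum>x\<in>X. d x) = (\<Sum>x\<in>X. min (d x) (T - 1) + (\<Sum>S\<in>layers T d. if x \<in> S then layer_count T d S else 0))"
    by (rule sum.cong[OF refl]) (rule sum_layer_count[OF fin assms(3)])
  also have "\<dots> = (\<Sum>x\<in>X. min (d x) (T - 1)) +
      (\<Sum>S\<in>layers T d. \<Sum>x\<in>X. if x \<in> S then layer_count T d S else 0)"
    by (subst sum.distrib, subst sum.swap) (rule refl)
  also have "(\<Sum>S\<in>layers T d. \<Sum>x\<in>X. if x \<in> S then layer_count T d S else 0)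
      = (\<Sum>S\<in>layers T d. card S * layer_count T d S)"
  proof (rule sum.cong[OF refl])
    fix S assume "S \<in> layers T d"
    then have "{x \<in> X. x \<in> S} = S" using layers_subset assms(2) by blast
    then show "(\<Sum>x\<in>X. if x \<in> S then layer_count T d S else 0) = card S * layer_count T d S"
      using sum.inter_filter[OF assms(1), of "\<lambda>_. layer_count T d S" "\<lambda>x. x \<in> S"] by simp
  qed
  finally show ?thesis .
qed

text \<open>
  Layers form a chain, so they have distinct sizes. This is why each factor \<open>1 - X ^ i\<close> is needed
  only once.
\<close>

lemma inj_on_card_layers:
  assumes "finite {x. T \<le> d x}"
  shows "inj_on card (layers T d)"
proof (rule inj_onI)
  fix S S' assume S: "S \<in> layers T d" "S' \<in> layers T d" "card S = card S'"
  then have "finite S" "finite S'" using assms layers_subset finite_subset by metis+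
  moreover from S obtain t t' where "S = {x. t \<le> d x}" "S' = {x. t' \<le> d x}"
    unfolding layers_def by blast
  then have "S \<subseteq> S' \<or> S' \<subseteq> S" by auto
  ultimately show "S = S'" using S(3) card_subset_eq by metis
qed

text \<open>The layer sizes are distinct elements of \<open>{1..card I}\<close>; \<open>Q\<close>
  collects the factors for the other sizes.\<close>

lemma prod_layers:
  assumes "finite I" "{x. T \<le> d x} \<subseteq> I"
  shows "\<exists>Q\<in>range fps_of_poly.
    (\<Prod>i=1..card I. 1 - fps_X ^ i :: 'a::comm_ring_1 fps) = (\<Prod>S\<in>layers T d. 1 - fps_X ^ card S) * Q"
proof
  let ?f = "\<lambda>i. 1 - fps_X ^ i :: 'a fps"
  let ?Q = "\<Prod>i\<in>{1..card I} - card ` layers T d. ?f i"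
  show "?Q \<in> range fps_of_poly"
    by (intro fps_of_poly_range_prod fps_of_poly_range_intros)
  have "card ` layers T d \<subseteq> {1..card I}"
  proof clarify
    fix S assume "S \<in> layers T d"
    with layers_Pow[OF assms(2)] have "S \<subseteq> I" "S \<noteq> {}" by auto
    with assms(1) have "finite S" "card S \<le> card I" by (auto intro: finite_subset card_mono)
    with \<open>S \<noteq> {}\<close> show "card S \<in> {1..card I}" by (simp add: Suc_le_eq card_gt_0_iff)
  qed
  then have "(\<Prod>i=1..card I. ?f i) = ?Q * prod ?f (card ` layers T d)"
    by (rule prod.subset_diff) simp
  also have "prod ?f (card ` layers T d) = (\<Prod>S\<in>layers T d. ?f (card S))"
    using inj_on_card_layers[OF finite_subset[OF assms(2,1)]] by (simp add: prod.reindex)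
  finally show "(\<Prod>i=1..card I. ?f i) = (\<Prod>S\<in>layers T d. ?f (card S)) * ?Q"
    by (simp only: mult.commute)
qed

text \<open>Repeating a layer preserves the part of \<open>d\<close> below \<open>T\<close> and the
  set of layers, and adds one to a single layer count. So each class of vectors with both data fixed
  corresponds to an up-set of count vectors.\<close>

lemma gf_layer_closed:
  fixes B :: "('x \<Rightarrow> nat) set" and T :: nat
  assumes X: "finite X" "I \<subseteq> X" and T: "T > 0" and B: "B \<subseteq> vecs X"
    and lvl: "\<And>d. d \<in> B \<Longrightarrow> {x. T \<le> d x} \<subseteq> I"
    and closed: "\<And>d t. d \<in> B \<Longrightarrow> T \<le> t \<Longrightarrow> repeat_layer t d \<in> B"
  shows "gf (\<lambda>d. \<Sum>x\<in>X. d x) B * (\<Prod>i=1..card I. 1 - fps_X ^ i) \<in> range fps_of_poly"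
proof -
  let ?D = "\<Prod>i=1..card I. 1 - fps_X ^ i :: rat fps"
  let ?deg = "\<lambda>d :: 'x \<Rightarrow> nat. \<Sum>x\<in>X. d x"
  define low :: "('x \<Rightarrow> nat) \<Rightarrow> 'x \<Rightarrow> nat" where "low d = (\<lambda>x. min (d x) (T - 1))" for d
  define p where "p d = (low d, layers T d)" for d
  have finI: "finite I" using X finite_subset by blast
  have finL: "finite {x. T \<le> d x}" if "d \<in> B" for d
    using finite_subset[OF lvl[OF that] finI] .
  have "low d \<in> {f. \<forall>x. (x \<in> X \<longrightarrow> f x \<in> {..T - 1}) \<and> (x \<notin> X \<longrightarrow> f x = 0)}" if "d \<in> B" for d
    using that B by (auto simp: low_def)
  \<comment> \<open>There are finitely many classes: low parts are bounded by \<open>T - 1\<close>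
    and vanish outside \<open>X\<close>, and layers are subsets of \<open>I\<close>.\<close>
  then have "p ` B \<subseteq> {f. \<forall>x. (x \<in> X \<longrightarrow> f x \<in> {..T - 1}) \<and> (x \<notin> X \<longrightarrow> f x = 0)} \<times> Pow (Pow I)"
    using layers_Pow[OF lvl] unfolding p_def by blast
  then have "finite (p ` B)"
    by (rule finite_subset) (intro finite_SigmaI finite_set_of_finite_funs X(1) finite_atMost, simp add: finI)
  moreover have "finite {d \<in> B. ?deg d = n}" for n
    by (rule finite_subset[OF _ finite_wdeg_slice[OF X(1), where m = "\<lambda>_. 1" and n = n]]) (use B in auto)
  ultimately have split: "gf ?deg B = (\<Sum>q\<in>p ` B. gf ?deg {d \<in> B. p d = q})"
    by (rule gf_eq_sum_fibers)
  have "gf ?deg {d \<in> B. p d = q} * ?D \<in> range fps_of_poly" if "q \<in> p ` B" for q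
  proof -
    from that obtain d0 where d0: "d0 \<in> B" "q = p d0" by blast
    define C where "C = layers T d0"
    define K where "K = {d \<in> B. p d = q}"
    have K: "d \<in> B" "low d = low d0" "layers T d = C" if "d \<in> K" for d
      using that d0(2) by (auto simp: K_def p_def C_def)
    have C: "finite C" "\<And>S. S \<in> C \<Longrightarrow> card S > 0"
    proof -
      show "finite C" unfolding C_def by (rule finite_layers[OF finL[OF d0(1)]])
      fix S assume "S \<in> C"
      then have "S \<noteq> {}" "S \<subseteq> I"
        using layers_Pow[OF lvl[OF d0(1)]] by (auto simp: C_def)
      then show "card S > 0" using finite_subset[OF _ finI] by (simp add: card_gt_0_iff)
    qed
    have eq: "d x = low d0 x + (\<Sum>S\<in>C. if x \<in> S then layer_count T d S else 0)" if "d \<in> K" for d x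
    proof -
      have low: "min (d x) (T - 1) = low d0 x"
        unfolding K(2)[OF that, symmetric] by (simp only: low_def)
      show ?thesis
        using sum_layer_count[OF finL[OF K(1)[OF that]] T, of x] unfolding low K(3)[OF that] .
    qed
    have inj: "inj_on (layer_count T) K"
    proof (rule inj_onI, rule ext)
      fix d d' x assume d: "d \<in> K" "d' \<in> K" and h: "layer_count T d = layer_count T d'"
      show "d x = d' x" by (rule trans[OF eq[OF d(1), of x, unfolded h] eq[OF d(2), of x, symmetric]])
    qed
    let ?U = "layer_count T ` K" and ?w = "\<lambda>w. \<Sum>S\<in>C. card S * w S"
    have deg: "?deg d = (\<Sum>x\<in>X. low d0 x) + ?w (layer_count T d)" if "d \<in> K" for d
    proof -
      have low: "low d0 = (\<lambda>x. min (d x) (T - 1))"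
        using K(2)[OF that] unfolding low_def[of d] by (rule sym)
      show ?thesis
        using sum_eq_sum_layer_count[OF X(1) subset_trans[OF lvl[OF K(1)[OF that]] X(2)] T]
        unfolding low K(3)[OF that] .
    qed
    have up: "gf ?w ?U * (\<Prod>S\<in>C. 1 - fps_X ^ card S) \<in> range fps_of_poly"
    proof (rule gf_upset[where J = C and m = card and U = ?U, OF C])
      show "?U \<subseteq> vecs C"
      proof (rule image_subsetI)
        fix d assume "d \<in> K"
        from layer_count_vecs[of T d] show "layer_count T d \<in> vecs C" unfolding K(3)[OF \<open>d \<in> K\<close>] .
      qed
      fix w S assume "w \<in> ?U" and S: "S \<in> C"
      then obtain d where d: "d \<in> K" "w = layer_count T d" by blast
      from S have "S \<in> layers T d" by (simp only: K(3)[OF d(1)])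
      then obtain t where t: "T \<le> t" "{x. t \<le> d x} = S" "S \<noteq> {}"
        unfolding layers_def by blast
      have "low (repeat_layer t d) = low d"
        using t(1) T by (auto simp: low_def repeat_layer_def fun_eq_iff)
      then have "p (repeat_layer t d) = p d"
        unfolding p_def layers_repeat_layer[OF t(1)] by (rule arg_cong)
      then have "repeat_layer t d \<in> K"
        using d(1) closed[OF K(1)[OF d(1)] t(1)] unfolding K_def by simp
      then have "layer_count T (repeat_layer t d) \<in> ?U" by (rule imageI)
      moreover have "layer_count T (repeat_layer t d) = w(S := Suc (w S))"
        using layer_count_repeat_layer[OF t] d(2) by simp
      ultimately show "w(S := Suc (w S)) \<in> ?U" by simp
    qed
    \<comment> \<open>The degree of \<open>d\<close> is a constant plus the weighted degree of its
      counts, so \<open>gf_image\<close> is applied to the inverse of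
      \<open>layer_count T\<close>.\<close>
    have "gf ?deg (inv_into K (layer_count T) ` ?U) = fps_X ^ (\<Sum>x\<in>X. low d0 x) * gf ?w ?U"
    proof (rule gf_image)
      show "inj_on (inv_into K (layer_count T)) ?U" by (rule inj_on_inv_into) (rule order_refl)
      fix w assume "w \<in> ?U"
      then obtain d where d: "d \<in> K" "w = layer_count T d" by blast
      show "?deg (inv_into K (layer_count T) w) = (\<Sum>x\<in>X. low d0 x) + ?w w"
        unfolding d(2) inv_into_f_f[OF inj d(1)] by (rule deg[OF d(1)])
    qed
    then have "gf ?deg K = fps_X ^ (\<Sum>x\<in>X. low d0 x) * gf ?w ?U"
      unfolding inv_into_image_cancel[OF inj order_refl] .
    moreover obtain Q where Q: "Q \<in> range fps_of_poly" "?D = (\<Prod>S\<in>C. 1 - fps_X ^ card S) * Q"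
      using prod_layers[OF finI lvl[OF d0(1)]] unfolding C_def by blast
    ultimately have "gf ?deg K * ?D = fps_X ^ (\<Sum>x\<in>X. low d0 x) * (gf ?w ?U * (\<Prod>S\<in>C. 1 - fps_X ^ card S)) * Q"
      by (simp only: mult.assoc)
    moreover have "fps_X ^ (\<Sum>x\<in>X. low d0 x) * (gf ?w ?U * (\<Prod>S\<in>C. 1 - fps_X ^ card S)) * Q \<in> range fps_of_poly"
      by (intro fps_of_poly_range_intros up Q(1))
    ultimately show ?thesis unfolding K_def[symmetric] by (simp only:)
  qed
  then show ?thesis
    unfolding split sum_distrib_right by (rule fps_of_poly_range_sum)
qed

section \<open>Quasi-polynomial coefficients\<close>

text \<open>Multiplying by \<open>1 - fps_X ^ N\<close> takes differences of coefficients at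
  distance \<open>N\<close>, which lowers \<open>k\<close> by one by Pascal's rule.\<close>

lemma fps_binomial_power:
  assumes "N > 0"
  shows "Abs_fps (\<lambda>n. if N dvd n then of_nat ((n div N + k) choose k) else 0)
    * (1 - fps_X ^ N) ^ Suc k = (1 :: 'a::comm_ring_1 fps)"
proof (induction k)
  case 0
  show ?case
  proof (rule fps_ext)
    fix n
    show "(Abs_fps (\<lambda>n. if N dvd n then of_nat ((n div N + 0) choose 0) else 0)
      * (1 - fps_X ^ N) ^ Suc 0) $ n = (1 :: 'a fps) $ n"
      using assms by (auto simp: right_diff_distrib fps_X_power_mult_right_nth dvd_minus_self
          not_less dest: dvd_imp_le)
  qed
next
  case (Suc k)
  let ?C = "\<lambda>k. Abs_fps (\<lambda>n. if N dvd n then of_nat ((n div N + k) choose k) else (0 :: 'a))"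
  have "?C (Suc k) * (1 - fps_X ^ N) = ?C k"
  proof (rule fps_ext)
    fix n
    show "(?C (Suc k) * (1 - fps_X ^ N)) $ n = ?C k $ n"
    proof (cases "N dvd n")
      case True
      then obtain a where n: "n = N * a" by blast
      show ?thesis
      proof (cases a)
        case 0
        with n assms show ?thesis by (simp add: right_diff_distrib fps_X_power_mult_right_nth)
      next
        case (Suc b)
        have "n - N = N * b" "\<not> n < N" by (simp_all add: n Suc)
        then show ?thesis using assms
          by (simp add: right_diff_distrib fps_X_power_mult_right_nth n Suc)
      qed
    next
      case False
      then show ?thesis
        by (auto simp: right_diff_distrib fps_X_power_mult_right_nth dvd_minus_self)
    qed
  qed
  then have "?C (Suc k) * (1 - fps_X ^ N) ^ Suc (Suc k) = ?C k * (1 - fps_X ^ N) ^ Suc k"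
    by (subst power_Suc, subst mult.assoc[symmetric]) (simp only:)
  then show ?case using Suc.IH by (simp only:)
qed

text \<open>The polynomial is the product of \<open>x + 1\<close> up to \<open>x + k\<close>,
  divided by \<open>fact k\<close>.\<close>

lemma binomial_poly:
  "\<exists>b :: 'a::field_char_0 poly. degree b \<le> k \<and> (\<forall>a. poly b (of_nat a) = of_nat ((a + k) choose k))"
proof (intro exI conjI allI)
  let ?b = "smult (1 / fact k) (\<Prod>i = 0..<k. [:of_nat (Suc i), 1:]) :: 'a poly"
  have "degree (\<Prod>i = 0..<k. [:of_nat (Suc i), 1 :: 'a:]) \<le> (\<Sum>i = 0..<k. degree [:of_nat (Suc i), 1 :: 'a:])"
    by (rule degree_prod_sum_le[OF finite_atLeastLessThan, unfolded comp_def])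
  then show "degree ?b \<le> k" using degree_smult_le[of "1 / fact k"] by simp
  fix a
  have "of_nat ((a + k) choose k) = (of_nat (a + k) gchoose k :: 'a)"
    by (rule binomial_gbinomial)
  also have "\<dots> = pochhammer (of_nat a + 1) k / fact k"
    by (simp add: gbinomial_pochhammer')
  also have "\<dots> = poly ?b (of_nat a)"
    by (simp add: pochhammer_prod poly_prod algebra_simps)
  finally show "poly ?b (of_nat a) = of_nat ((a + k) choose k)" by simp
qed

text \<open>Each \<open>i\<close> in \<open>{1..k}\<close> divides \<open>fact k\<close>, so
  \<open>1 - fps_X ^ i\<close> divides \<open>1 - fps_X ^ fact k\<close>, with a finite geometric
  sum as quotient.\<close>

lemma prod_one_minus_X_power_dvd:
  fixes k :: nat
  shows "\<exists>Q\<in>range fps_of_poly. (\<Prod>i=1..k. 1 - fps_X ^ i) * Q = (1 - fps_X ^ fact k :: 'a::comm_ring_1 fps) ^ k"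
proof -
  let ?Q = "\<lambda>i. \<Sum>j<fact k div i. (fps_X ^ i :: 'a fps) ^ j"
  have "(1 - fps_X ^ i) * ?Q i = 1 - fps_X ^ fact k" if "i \<in> {1..k}" for i
  proof -
    have "i dvd fact k" using that by (intro dvd_fact) auto
    then have "i * (fact k div i) = fact k" by simp
    then show ?thesis using one_diff_power_eq[of "fps_X ^ i :: 'a fps" "fact k div i"]
      by (simp add: power_mult[symmetric])
  qed
  then have "(\<Prod>i=1..k. 1 - fps_X ^ i) * (\<Prod>i=1..k. ?Q i) = (\<Prod>i=1..k. 1 - fps_X ^ fact k)"
    unfolding prod.distrib[symmetric] by (intro prod.cong) auto
  moreover have "(\<Prod>i=1..k. ?Q i) \<in> range fps_of_poly"
    by (intro fps_of_poly_range_prod fps_of_poly_range_sum fps_of_poly_range_intros)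
  ultimately show ?thesis by auto
qed

text \<open>Over the common denominator \<open>(1 - fps_X ^ N) ^ k\<close>, the coefficient at
  \<open>n\<close> is a sum over the \<open>i\<close> congruent to \<open>n\<close> modulo
  \<open>N\<close>: a coefficient of the numerator times a binomial of degree \<open>k - 1\<close>
  in \<open>(n - i) div N\<close>.\<close>

lemma quasi_polynomial_of_rational:
  assumes F: "generating_series \<phi> * (\<Prod>i=1..k. 1 - fps_X ^ i) \<in> range fps_of_poly" and "k > 0"
  shows "eventually_quasi_polynomial \<phi> k"
proof -
  define N :: nat where "N = fact k"
  have N: "N > 0" by (simp add: N_def)
  obtain k' where k': "k = Suc k'" using \<open>k > 0\<close> gr0_implies_Suc by blast
  obtain Q where Q: "Q \<in> range fps_of_poly" "(\<Prod>i=1..k. 1 - fps_X ^ i) * Q = (1 - fps_X ^ N :: rat fps) ^ k"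
    using prod_one_minus_X_power_dvd[of k] unfolding N_def by blast
  define G where "G = generating_series \<phi> * (1 - fps_X ^ N) ^ k"
  have "G \<in> range fps_of_poly"
    using fps_of_poly_range_intros(3)[OF F Q(1)] by (simp only: G_def Q(2)[symmetric] mult.assoc)
  then obtain P where P: "G = fps_of_poly P" by blast
  let ?C = "Abs_fps (\<lambda>n. if N dvd n then of_nat ((n div N + k') choose k') else 0) :: rat fps"
  have "?C * (1 - fps_X ^ N) ^ k = 1"
    using fps_binomial_power[OF N] by (simp only: k')
  moreover have "fps_of_poly P * ?C = generating_series \<phi> * (?C * (1 - fps_X ^ N) ^ k)"
    unfolding P[symmetric] G_def by (simp only: mult.assoc mult.commute[of ?C])
  ultimately have gen: "generating_series \<phi> = fps_of_poly P * ?C" by simp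
  obtain b :: "rat poly" where b: "degree b \<le> k'" "\<And>a. poly b (of_nat a) = of_nat ((a + k') choose k')"
    using binomial_poly by blast
  \<comment> \<open>\<open>p r\<close> gathers the contributions to all \<open>n\<close> of residue
    \<open>r\<close>; the inner linear polynomial is \<open>(x - i) / N\<close>.\<close>
  define p where "p r = (\<Sum>i\<le>degree P. if i mod N = r
    then smult (coeff P i) (pcompose b [:- of_nat i / of_nat N, 1 / of_nat N:]) else 0)" for r
  have deg: "degree (p r) \<le> k'" for r
    unfolding p_def
  proof (rule degree_sum_le)
    fix i
    have "degree (pcompose b [:- of_nat i / of_nat N, 1 / of_nat N:]) \<le> k'"
      using b(1) N by (simp add: degree_pcompose)
    then show "degree (if i mod N = r then smult (coeff P i) (pcompose b [:- of_nat i / of_nat N, 1 / of_nat N:]) else 0) \<le> k'"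
      using degree_smult_le order_trans by auto
  qed simp
  \<comment> \<open>From \<open>degree P\<close> on, all of \<open>P\<close> enters the convolution,
    and \<open>n - i\<close> is never truncated.\<close>
  have val: "of_nat (\<phi> n) = poly (p (n mod N)) (of_nat n)" if n: "n \<ge> degree P" for n
  proof -
    have "of_nat (\<phi> n) = generating_series \<phi> $ n" by (simp add: generating_series_def)
    also have "\<dots> = (\<Sum>i=0..n. coeff P i * ?C $ (n - i))"
      by (simp only: gen fps_mult_nth fps_of_poly_nth)
    also have "\<dots> = (\<Sum>i\<le>degree P. coeff P i * ?C $ (n - i))"
      by (rule sum.mono_neutral_right) (use n in \<open>auto simp: coeff_eq_0\<close>)
    also have "\<dots> = (\<Sum>i\<le>degree P. poly (if i mod N = n mod N
      then smult (coeff P i) (pcompose b [:- of_nat i / of_nat N, 1 / of_nat N:]) else 0) (of_nat n))"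
    proof (rule sum.cong[OF refl])
      fix i assume "i \<in> {..degree P}"
      with n have i: "i \<le> n" by simp
      have dvd: "N dvd n - i \<longleftrightarrow> i mod N = n mod N"
        using mod_eq_dvd_iff_nat[OF i, of N] by auto
      show "coeff P i * ?C $ (n - i) = poly (if i mod N = n mod N
        then smult (coeff P i) (pcompose b [:- of_nat i / of_nat N, 1 / of_nat N:]) else 0) (of_nat n)"
      proof (cases "N dvd n - i")
        case True
        then have "rat_of_nat ((n - i) div N) = - of_nat i / of_nat N + of_nat n * (1 / of_nat N)"
        proof -
          from True obtain a where "n - i = N * a" by blast
          moreover from this i have "n = i + N * a" by simp
          ultimately show ?thesis using N by (simp add: field_simps)
        qed
        then show ?thesis using True dvd b(2)[of "(n - i) div N"] by (simp add: poly_pcompose)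
      qed (simp add: dvd)
    qed
    also have "\<dots> = poly (p (n mod N)) (of_nat n)" by (simp add: p_def poly_sum)
    finally show ?thesis .
  qed
  show ?thesis
    unfolding eventually_quasi_polynomial_def
  proof (intro exI[of _ "\<lambda>j n. coeff (p (n mod N)) j"] conjI allI impI)
    show "periodic (\<lambda>n. coeff (p (n mod N)) j)" for j
      unfolding periodic_def using N by (intro exI[of _ N]) simp
    have "poly (p r) x = (\<Sum>j<k. coeff (p r) j * x ^ j)" for r x
      unfolding poly_altdef using deg[of r] k'
      by (intro sum.mono_neutral_left) (auto simp: coeff_eq_0)
    then show "\<forall>\<^sub>F n in sequentially. of_nat (\<phi> n) = (\<Sum>j<k. coeff (p (n mod N)) j * of_nat n ^ j)"
      using val by (auto simp: eventually_sequentially intro!: exI[of _ "degree P"])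
  qed
qed

section \<open>Size vectors of finite subsets\<close>

definition sizes :: "'a set set \<Rightarrow> 'a set \<Rightarrow> 'a set \<Rightarrow> nat" where
  "sizes P A = (\<lambda>x. if x \<in> P then card (A \<inter> x) else 0)"

lemma sum_sizes:
  assumes "finite P" "disjoint P" "finite A" "A \<subseteq> \<Union>P"
  shows "(\<Sum>x\<in>P. sizes P A x) = card A"
proof -
  have "card (\<Union>x\<in>P. A \<inter> x) = (\<Sum>x\<in>P. card (A \<inter> x))"
    by (rule card_UN_disjoint) (use assms disjointD[OF assms(2)] in auto)
  moreover have "(\<Union>x\<in>P. A \<inter> x) = A" using assms(4) by auto
  ultimately show ?thesis by (simp add: sizes_def)
qed

text \<open>Points are chosen in each block separately, as blocks are disjoint. An infinite
  \<open>C \<inter> x\<close> contains sets of every finite size.\<close>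

lemma ex_sizes:
  assumes "finite P" "disjoint P" and d: "d \<in> vecs P"
    and le: "\<And>x. x \<in> P \<Longrightarrow> finite (C \<inter> x) \<Longrightarrow> d x \<le> card (C \<inter> x)"
  shows "\<exists>A\<subseteq>C. finite A \<and> A \<subseteq> \<Union>P \<and> sizes P A = d"
proof -
  have "\<exists>A. A \<subseteq> C \<inter> x \<and> finite A \<and> card A = d x" if "x \<in> P" for x
  proof (cases "finite (C \<inter> x)")
    case True
    with obtain_subset_with_card_n[OF le[OF that True]] show ?thesis by metis
  next
    case False
    with infinite_arbitrarily_large[OF False, of "d x"] show ?thesis by metis
  qed
  then obtain a where a: "\<And>x. x \<in> P \<Longrightarrow> a x \<subseteq> C \<inter> x \<and> finite (a x) \<and> card (a x) = d x"
    by metis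
  have "(\<Union>y\<in>P. a y) \<inter> x = a x" if "x \<in> P" for x
  proof -
    have "a y \<inter> x = {}" if "y \<in> P" "y \<noteq> x" for y
      using a[OF \<open>y \<in> P\<close>] disjointD[OF assms(2) \<open>y \<in> P\<close> \<open>x \<in> P\<close>] that by blast
    then show ?thesis using a[OF that] that by blast
  qed
  then have "sizes P (\<Union>y\<in>P. a y) = d"
    using d a by (auto simp: sizes_def fun_eq_iff)
  moreover have "(\<Union>y\<in>P. a y) \<subseteq> C" "(\<Union>y\<in>P. a y) \<subseteq> \<Union>P" "finite (\<Union>y\<in>P. a y)"
    using a assms(1) by blast+
  ultimately show ?thesis by blast
qed

lemma sizes_insert:
  assumes "finite A" "a \<notin> A" "a \<in> x" "x \<in> P" "disjoint P"
  shows "sizes P (insert a A) = (sizes P A)(x := Suc (sizes P A x))"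
proof
  fix y
  have "a \<notin> y" if "y \<in> P" "y \<noteq> x"
    using disjointD[OF assms(5,4) that(1)] that(2) assms(3) by blast
  then show "sizes P (insert a A) y = ((sizes P A)(x := Suc (sizes P A x))) y"
    using assms by (auto simp: sizes_def)
qed

section \<open>Isomorphisms between induced substructures\<close>

abbreviation induced_iso :: "('a, 'i) rel_structure \<Rightarrow> 'a set \<Rightarrow> 'a set \<Rightarrow> bool" where
  "induced_iso R A B \<equiv> isomorphic (induced R A) (induced R B)"

text \<open>Names the isomorphism itself, so that it can be restricted to subsets.\<close>

definition iso_map :: "('a, 'i) rel_structure \<Rightarrow> ('a \<Rightarrow> 'a) \<Rightarrow> 'a set \<Rightarrow> 'a set \<Rightarrow> bool" where
  "iso_map R f A B \<longleftrightarrow> bij_betw f A B \<and>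
    (\<forall>i\<in>index R. map f ` (rel R i \<inter> nlists (arity R i) A) = rel R i \<inter> nlists (arity R i) B)"

lemma iso_iff: "induced_iso R A B \<longleftrightarrow> (\<exists>f. iso_map R f A B)"
  by (simp add: isomorphic_induced_iff iso_map_def)

lemma iso_map_restrict:
  assumes f: "iso_map R f A B" and C: "C \<subseteq> A"
  shows "iso_map R f C (f ` C)"
  unfolding iso_map_def
proof (intro conjI ballI)
  have bij: "bij_betw f A B" using f by (simp add: iso_map_def)
  then have inj: "inj_on f A" by (rule bij_betw_imp_inj_on)
  then show "bij_betw f C (f ` C)" using C by (simp add: bij_betw_def inj_on_subset)
  fix i assume "i \<in> index R"
  let ?r = "rel R i" and ?n = "arity R i"
  have img: "map f ` (?r \<inter> nlists ?n A) = ?r \<inter> nlists ?n B"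
    using f \<open>i \<in> index R\<close> by (simp add: iso_map_def)
  have fC: "f ` C \<subseteq> B" using bij_betw_imp_surj_on[OF bij] C by blast
  show "map f ` (?r \<inter> nlists ?n C) = ?r \<inter> nlists ?n (f ` C)"
  proof (intro equalityI subsetI)
    fix ys assume "ys \<in> map f ` (?r \<inter> nlists ?n C)"
    then obtain xs where xs: "xs \<in> ?r" "xs \<in> nlists ?n C" "ys = map f xs" by blast
    then have "xs \<in> nlists ?n A" using nlists_mono[OF C] by blast
    then have "ys \<in> ?r" using img xs by blast
    moreover have "ys \<in> nlists ?n (f ` C)" using xs(2,3) by (auto simp: nlists_def)
    ultimately show "ys \<in> ?r \<inter> nlists ?n (f ` C)" by simp
  next
    fix ys assume ys: "ys \<in> ?r \<inter> nlists ?n (f ` C)"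
    then have "ys \<in> ?r \<inter> nlists ?n B" using nlists_mono[OF fC] by blast
    then obtain xs where xs: "xs \<in> ?r" "xs \<in> nlists ?n A" "ys = map f xs" using img by blast
    \<comment> \<open>The tuple has a preimage over \<open>A\<close>; injectivity of
      \<open>f\<close> places its entries in \<open>C\<close>.\<close>
    have "x \<in> C" if "x \<in> set xs" for x
    proof -
      have "f x \<in> f ` C" using ys xs(3) that by (auto simp: nlists_def)
      moreover have "x \<in> A" using xs(2) that by (auto simp: nlists_def)
      ultimately show ?thesis using inj C by (auto dest: inj_onD)
    qed
    then have "xs \<in> nlists ?n C" using xs(2) by (auto simp: nlists_def)
    then show "ys \<in> map f ` (?r \<inter> nlists ?n C)" using xs by blast
  qed
qed

lemma iso_image: "iso_map R f A B \<Longrightarrow> C \<subseteq> A \<Longrightarrow> induced_iso R C (f ` C)"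
  using iso_map_restrict iso_iff by blast

lemma iso_refl: "induced_iso R A A"
  unfolding iso_iff by (rule exI[of _ id]) (simp add: iso_map_def)

lemma iso_card: "induced_iso R A B \<Longrightarrow> card A = card B"
  unfolding iso_iff iso_map_def by (blast dest: bij_betw_same_card)

lemma iso_of_sizes_eq:
  assumes dec: "monomorphic_decomposition R P" and "finite P"
    and "finite A" "A \<subseteq> dom_of R" "finite B" "B \<subseteq> dom_of R" and sizes: "sizes P A = sizes P B"
  shows "induced_iso R A B"
proof -
  have part: "disjoint P" "\<Union>P = dom_of R"
    using dec by (auto simp: monomorphic_decomposition_def partition_on_def)
  have "card A = card B"
    using sum_sizes[OF assms(2) part(1), of A] sum_sizes[OF assms(2) part(1), of B] assms part(2) by simp
  moreover have "card (A \<inter> x) = card (B \<inter> x)" if "x \<in> P" for x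
    using fun_cong[OF sizes, of x] that by (simp add: sizes_def)
  moreover have "A \<in> nsubsets (dom_of R) (card B)" "B \<in> nsubsets (dom_of R) (card B)"
    using assms \<open>card A = card B\<close> by (simp_all add: nsubsets_def)
  ultimately show ?thesis using dec unfolding monomorphic_decomposition_def by blast
qed

section \<open>Optimal representatives of isomorphism classes\<close>

text \<open>Raising a value from \<open>a\<close> to \<open>a + 1\<close> gains
  \<open>card X * Suc (card X) ^ a\<close>, which strictly grows with \<open>a\<close> for nonempty
  \<open>X\<close>, so unbalanced vectors are favoured. The base exceeds \<open>card X\<close> so
  that one value \<open>t\<close> outweighs \<open>card X\<close> values below
  \<open>t\<close>.\<close>

definition weight :: "'x set \<Rightarrow> ('x \<Rightarrow> nat) \<Rightarrow> nat" where
  "weight X d = (\<Sum>x\<in>X. Suc (card X) ^ d x)"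

text \<open>Lists are ordered lexicographically, so the weight at the head is the primary criterion.
  The enumeration of \<open>X\<close> is arbitrary but fixed.\<close>

definition key :: "'x set \<Rightarrow> ('x \<Rightarrow> nat) \<Rightarrow> nat list" where
  "key X d = weight X d # map d (SOME xs. set xs = X)"

lemma set_some_list: "finite X \<Longrightarrow> set (SOME xs. set xs = X) = X"
  by (rule someI_ex) (rule finite_list)

lemma key_less_weight: "weight X d < weight X d' \<Longrightarrow> key X d < key X d'"
  by (simp add: key_def)

lemma key_inj:
  assumes "finite X" "d \<in> vecs X" "d' \<in> vecs X" "key X d = key X d'"
  shows "d = d'"
proof
  fix x show "d x = d' x"
    using assms set_some_list[OF assms(1)] by (cases "x \<in> X") (auto simp: key_def map_eq_conv)
qed

lemma weight_upd:
  assumes "finite X" "x \<in> X"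
  shows "weight X (g(x := Suc (g x))) = weight X g + card X * Suc (card X) ^ g x"
proof -
  have "(\<Sum>y\<in>X - {x}. Suc (card X) ^ (g(x := Suc (g x))) y) = (\<Sum>y\<in>X - {x}. Suc (card X) ^ g y)"
    by (rule sum.cong) auto
  then show ?thesis
    unfolding weight_def sum.remove[OF assms] by simp
qed

lemma map_less_map_comp:
  fixes u v :: "'x \<Rightarrow> nat"
  assumes \<phi>: "\<And>a b. a \<in> S \<Longrightarrow> b \<in> S \<Longrightarrow> a < b \<Longrightarrow> \<phi> a < (\<phi> b :: nat)"
    and "\<And>x. x \<in> set xs \<Longrightarrow> u x \<in> S \<and> v x \<in> S" and "map u xs < map v xs"
  shows "map (\<lambda>x. \<phi> (u x)) xs < map (\<lambda>x. \<phi> (v x)) xs"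
  using assms(2,3) by (induction xs) (auto intro: \<phi>)

text \<open>
  Here \<open>u\<close> is the size vector of a set \<open>B\<close>, and \<open>v\<close> that of a set isomorphic to \<open>B\<close>. One element of \<open>B\<close> is
  removed from each block in \<open>S\<close>, and the corresponding one from each block in \<open>\<tau> ` S\<close>. As
  \<open>v (\<tau> x) \<le> u x\<close>, the weight of \<open>v\<close> decreases at most as much as that of \<open>u\<close>. If the weights are tied
  afterwards, then the high values of \<open>v\<close> are exactly those on \<open>\<tau> ` S\<close>, and the removal acts
  on \<open>u\<close> and \<open>v\<close> by the same function of values, which preserves the lexicographic order.
\<close>

lemma key_remove_layer:
  fixes u v :: "'x \<Rightarrow> nat"
  assumes X: "finite X" "S \<subseteq> X" "inj_on \<tau> S" "\<tau> ` S \<subseteq> X" and t: "t > 0"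
    and high: "\<And>x. x \<in> S \<Longrightarrow> t < u x" and low: "\<And>x. x \<in> X - S \<Longrightarrow> u x < t"
    and \<tau>: "\<And>x. x \<in> S \<Longrightarrow> 0 < v (\<tau> x) \<and> v (\<tau> x) \<le> u x"
    and less: "key X u < key X v"
  shows "key X (\<lambda>x. if x \<in> S then u x - 1 else u x) < key X (\<lambda>x. if x \<in> \<tau> ` S then v x - 1 else v x)"
    (is "key X ?u < key X ?v")
proof (cases "X = {}")
  case True
  with less show ?thesis by (simp add: key_def weight_def)
next
  case False
  define K where "K = Suc (card X)"
  have "card X > 0" using X(1) False by (simp add: card_gt_0_iff)
  then have K: "K > 1" by (simp add: K_def)
  \<comment> \<open>\<open>\<Delta> a\<close> is the weight lost when a value \<open>a > 0\<close>
    drops by one. As \<open>\<Delta> 0 = \<Delta> 1\<close>, strict growth is restricted to positive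
    arguments.\<close>
  define \<Delta> where "\<Delta> a = card X * K ^ (a - 1)" for a
  have \<Delta>: "K ^ a = K ^ (a - 1) + \<Delta> a" if "a > 0" for a
    using that by (cases a) (simp_all add: \<Delta>_def K_def)
  have \<Delta>_mono: "\<Delta> a \<le> \<Delta> b" if "a \<le> b" for a b
    using that K by (auto simp: \<Delta>_def intro!: power_increasing)
  have \<Delta>_strict: "\<Delta> a < \<Delta> b" if "0 < a" "a < b" for a b
    using that K \<open>card X > 0\<close> by (auto simp: \<Delta>_def)
  have weight: "weight X w = weight X (\<lambda>x. if x \<in> Y then w x - 1 else w x) + (\<Sum>x\<in>Y. \<Delta> (w x))"
    if "Y \<subseteq> X" "\<And>x. x \<in> Y \<Longrightarrow> 0 < w x" for w Y
  proof -
    have "weight X w = (\<Sum>x\<in>X. K ^ (if x \<in> Y then w x - 1 else w x) + (if x \<in> Y then \<Delta> (w x) else 0))"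
      unfolding weight_def K_def[symmetric] by (rule sum.cong) (use \<Delta> that(2) in auto)
    also have "\<dots> = weight X (\<lambda>x. if x \<in> Y then w x - 1 else w x) + (\<Sum>x\<in>X. if x \<in> Y then \<Delta> (w x) else 0)"
      unfolding weight_def K_def[symmetric] by (rule sum.distrib)
    also have "(\<Sum>x\<in>X. if x \<in> Y then \<Delta> (w x) else 0) = (\<Sum>x\<in>Y. \<Delta> (w x))"
      using sum.inter_restrict[OF X(1), of "\<lambda>x. \<Delta> (w x)" Y] that(1) by (simp add: Int_absorb1)
    finally show ?thesis .
  qed
  have u: "weight X u = weight X ?u + (\<Sum>x\<in>S. \<Delta> (u x))"
    by (rule weight[OF X(2)]) (use high in fastforce)
  have v: "weight X v = weight X ?v + (\<Sum>x\<in>S. \<Delta> (v (\<tau> x)))"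
    using weight[OF X(4), of v] \<tau> by (auto simp: sum.reindex[OF X(3)])
  have finS: "finite S" using X(1,2) finite_subset by blast
  have le: "(\<Sum>x\<in>S. \<Delta> (v (\<tau> x))) \<le> (\<Sum>x\<in>S. \<Delta> (u x))"
    by (rule sum_mono) (use \<tau> \<Delta>_mono in blast)
  have less': "weight X u < weight X v \<or>
      weight X u = weight X v \<and> map u (SOME xs. set xs = X) < map v (SOME xs. set xs = X)"
    using less by (simp add: key_def)
  show ?thesis
  proof (cases "weight X ?u < weight X ?v")
    case True then show ?thesis by (rule key_less_weight)
  next
    case False
    \<comment> \<open>The weight of \<open>v\<close> was no smaller and dropped by no more, yet does
      not end up larger. So all these inequalities are equalities, and \<open>less\<close> was
      decided lexicographically.\<close>
    with u v le less' have w: "weight X u = weight X v" "weight X ?u = weight X ?v"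
      and sum: "(\<Sum>x\<in>S. \<Delta> (v (\<tau> x))) = (\<Sum>x\<in>S. \<Delta> (u x))"
      and lex: "map u (SOME xs. set xs = X) < map v (SOME xs. set xs = X)"
      by auto
    have eq: "v (\<tau> x) = u x" if "x \<in> S" for x
    proof (rule ccontr)
      assume "v (\<tau> x) \<noteq> u x"
      with \<tau>[OF that] have "\<Delta> (v (\<tau> x)) < \<Delta> (u x)" by (intro \<Delta>_strict) auto
      moreover have "\<forall>x\<in>S. \<Delta> (v (\<tau> x)) \<le> \<Delta> (u x)" using \<tau> \<Delta>_mono by blast
      ultimately have "(\<Sum>x\<in>S. \<Delta> (v (\<tau> x))) < (\<Sum>x\<in>S. \<Delta> (u x))"
        using finS that by (intro sum_strict_mono_ex1) auto
      with sum show False by simp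
    qed
    have split: "weight X w = (\<Sum>x\<in>X - Y. K ^ w x) + (\<Sum>x\<in>Y. K ^ w x)" if "Y \<subseteq> X" for w Y
      unfolding weight_def K_def by (rule sum.subset_diff[OF that X(1)])
    have "(\<Sum>x\<in>\<tau> ` S. K ^ v x) = (\<Sum>x\<in>S. K ^ u x)"
      by (simp add: sum.reindex[OF X(3)] eq)
    with w(1) split[OF X(2), of u] split[OF X(4), of v]
    have rest: "(\<Sum>x\<in>X - \<tau> ` S. K ^ v x) = (\<Sum>x\<in>X - S. K ^ u x)" by simp
    \<comment> \<open>Outside the image of \<open>S\<close>, \<open>v\<close> has the weight that
      \<open>u\<close> has outside \<open>S\<close>, at most \<open>card X * K ^ (t - 1)\<close>.
      One value of at least \<open>t\<close> would exceed this.\<close>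
    have v_low: "v y < t" if "y \<in> X - \<tau> ` S" for y
    proof -
      have "K ^ v y \<le> (\<Sum>x\<in>X - \<tau> ` S. K ^ v x)"
        using that X(1) by (intro member_le_sum) auto
      also have "\<dots> \<le> (\<Sum>x\<in>X - S. K ^ (t - 1))"
        unfolding rest by (rule sum_mono) (use low K in \<open>fastforce intro: power_increasing\<close>)
      also have "\<dots> \<le> card X * K ^ (t - 1)"
        using X(1) by (simp add: card_mono)
      also have "\<dots> < K ^ t" using K t by (cases t) (simp_all add: K_def)
      finally show ?thesis using K by (simp add: power_strict_increasing_iff)
    qed
    \<comment> \<open>\<open>\<phi>\<close> identifies \<open>t\<close> and \<open>t + 1\<close>,
      but no value of \<open>u\<close> or \<open>v\<close> equals \<open>t\<close>: the high ones
      exceed it and the others lie below.\<close>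
    define \<phi> :: "nat \<Rightarrow> nat" where "\<phi> a = (if t < a then a - 1 else a)" for a
    have \<phi>: "\<phi> a < \<phi> b" if "a \<in> - {t}" "b \<in> - {t}" "a < b" for a b
      using that by (auto simp: \<phi>_def)
    let ?xs = "SOME xs. set xs = X"
    have vals: "u x \<in> - {t} \<and> v x \<in> - {t} \<and> ?u x = \<phi> (u x) \<and> ?v x = \<phi> (v x)" if "x \<in> set ?xs" for x
    proof -
      have "x \<in> X" using that set_some_list[OF X(1)] by simp
      moreover have "t < v x" if "x \<in> \<tau> ` S" using that eq high by force
      ultimately show ?thesis
        using high[of x] low[of x] v_low[of x] by (cases "x \<in> S"; cases "x \<in> \<tau> ` S") (auto simp: \<phi>_def)
    qed
    then have "map ?u ?xs = map (\<lambda>x. \<phi> (u x)) ?xs" "map ?v ?xs = map (\<lambda>x. \<phi> (v x)) ?xs"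
      by (simp_all only: map_eq_conv) blast+
    moreover have "map (\<lambda>x. \<phi> (u x)) ?xs < map (\<lambda>x. \<phi> (v x)) ?xs"
      by (rule map_less_map_comp[OF \<phi> _ lex, where S = "- {t}"]) (use vals in blast)+
    ultimately have "map ?u ?xs < map ?v ?xs" by (simp only:)
    with w(2) show ?thesis unfolding key_def Cons_less_Cons by blast
  qed
qed

definition optimal :: "('a, 'i) rel_structure \<Rightarrow> 'a set set \<Rightarrow> 'a set \<Rightarrow> bool" where
  "optimal R P A \<longleftrightarrow> finite A \<and> A \<subseteq> dom_of R \<and>
    (\<forall>A'. finite A' \<and> A' \<subseteq> dom_of R \<and> induced_iso R A A' \<longrightarrow> key P (sizes P A') \<le> key P (sizes P A))"

lemma optimal_of_sizes_eq:
  assumes "monomorphic_decomposition R P" "finite P" "optimal R P A"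
    and "finite B" "B \<subseteq> dom_of R" "sizes P B = sizes P A"
  shows "optimal R P B"
proof -
  have "induced_iso R A B" using iso_of_sizes_eq[OF assms(1,2)] assms(3-) by (simp add: optimal_def)
  then show ?thesis using assms(3-) isomorphic_trans unfolding optimal_def by metis
qed

text \<open>
  If \<open>f a\<close> and \<open>f b\<close> lie in the same block, then \<open>a\<close> and \<open>b\<close> are interchangeable in \<open>B\<close>. Moving a point
  from a block to one that is at least as full increases the weight.
\<close>

lemma optimal_separates:
  assumes dec: "monomorphic_decomposition R P" "finite P"
    and opt: "optimal R P A0" and f: "iso_map R f B B''"
    and B: "finite B" "B \<subseteq> dom_of R" "finite B''" "B'' \<subseteq> dom_of R"
    and ab: "a \<in> B" "b \<in> B" "a \<in> x" "b \<in> y" "x \<in> P" "y \<in> P" "x \<noteq> y"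
    and z: "f a \<in> z" "f b \<in> z" "z \<in> P"
    and le: "sizes P A0 \<le> sizes P B" and x: "sizes P A0 x < sizes P B x"
    and y: "0 < sizes P A0 y" "sizes P A0 y \<le> sizes P A0 x"
  shows False
proof -
  \<comment> \<open>A set \<open>G\<close> of sizes \<open>?g\<close> avoiding \<open>a\<close> and
    \<open>b\<close> makes \<open>insert b G\<close> a copy of \<open>A0\<close> in sizes, while
    \<open>insert a G\<close> has one point moved from \<open>y\<close> to \<open>x\<close>.\<close>
  let ?d = "sizes P A0" and ?g = "(sizes P A0)(y := sizes P A0 y - 1)"
  have part: "disjoint P" "\<Union>P = dom_of R"
    using dec(1) by (auto simp: monomorphic_decomposition_def partition_on_def)
  have bij: "bij_betw f B B''" using f by (simp add: iso_map_def)
  have notin: "a \<notin> y" "b \<notin> x" using ab disjointD[OF part(1) ab(5,6)] by blast+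
  have "\<exists>G\<subseteq>B - {a, b}. finite G \<and> G \<subseteq> \<Union>P \<and> sizes P G = ?g"
  proof (rule ex_sizes[OF dec(2) part(1)])
    show "?g \<in> vecs P" using ab(6) by (auto simp: sizes_def)
    fix w assume w: "w \<in> P"
    have dw: "?d w \<le> card (B \<inter> w)" using le_funD[OF le, of w] w by (simp add: sizes_def)
    consider "w = x" | "w = y" | "a \<notin> w" "b \<notin> w"
      using disjointD[OF part(1) w ab(5)] disjointD[OF part(1) w ab(6)] ab(3,4) by blast
    then show "?g w \<le> card ((B - {a, b}) \<inter> w)"
    proof cases
      case 1
      then have "(B - {a, b}) \<inter> w = B \<inter> w - {a}" using notin by blast
      then have "card ((B - {a, b}) \<inter> w) = card (B \<inter> w) - 1" using 1 ab B(1) by simp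
      moreover have "?d x < card (B \<inter> x)" using x ab(5) by (simp add: sizes_def)
      ultimately show ?thesis using 1 ab(7) by simp
    next
      case 2
      then have "(B - {a, b}) \<inter> w = B \<inter> w - {b}" using notin by blast
      then have "card ((B - {a, b}) \<inter> w) = card (B \<inter> w) - 1" using 2 ab B(1) by simp
      then show ?thesis using 2 dw by simp
    next
      case 3
      then have "(B - {a, b}) \<inter> w = B \<inter> w" by blast
      moreover have "w \<noteq> y" using 3 ab(4) by blast
      ultimately show ?thesis using dw by simp
    qed
  qed
  then obtain G where G: "G \<subseteq> B - {a, b}" "finite G" "sizes P G = ?g" by blast
  have GB: "insert a G \<subseteq> B" "insert b G \<subseteq> B" using G(1) ab by blast+
  have inj: "inj_on f B" using bij by (rule bij_betw_imp_inj_on)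
  have fin: "f c \<notin> f ` G" if "c \<in> {a, b}" for c
    using G(1) that ab(1,2) inj by (auto dest: inj_onD)
  \<comment> \<open>Here \<open>f a\<close> and \<open>f b\<close> add a point to the same block
    \<open>z\<close>.\<close>
  have "sizes P (f ` insert a G) = sizes P (f ` insert b G)"
    unfolding image_insert
    using sizes_insert[OF finite_imageI[OF G(2)] fin z(1) z(3) part(1)]
      sizes_insert[OF finite_imageI[OF G(2)] fin z(2) z(3) part(1)] by simp
  moreover have "f ` insert a G \<subseteq> dom_of R" "f ` insert b G \<subseteq> dom_of R"
    using bij_betw_imp_surj_on[OF bij] GB B(4) by blast+
  ultimately have "induced_iso R (f ` insert a G) (f ` insert b G)"
    using G(2) by (intro iso_of_sizes_eq[OF dec]) auto
  then have iso: "induced_iso R (insert b G) (insert a G)"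
    using iso_image[OF f GB(1)] iso_image[OF f GB(2)] isomorphic_trans isomorphic_sym by meson
  have notG: "a \<notin> G" "b \<notin> G" using G(1) by blast+
  have sb: "sizes P (insert b G) = ?d"
    unfolding sizes_insert[OF G(2) notG(2) ab(4,6) part(1)] G(3) using y(1) by simp
  have sa: "sizes P (insert a G) = ?g(x := Suc (?g x))"
    unfolding sizes_insert[OF G(2) notG(1) ab(3,5) part(1)] G(3) ..
  have "optimal R P (insert b G)"
    by (rule optimal_of_sizes_eq[OF dec opt]) (use G(2) GB B(2) sb in auto)
  then have "key P (sizes P (insert a G)) \<le> key P ?d"
    using iso G(2) GB B(2) unfolding optimal_def sb by blast
  \<comment> \<open>The gain in \<open>x\<close> occurs at height \<open>?d x\<close>, the loss in
    \<open>y\<close> at the smaller height \<open>?d y - 1\<close>.\<close>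
  moreover have "weight P ?d < weight P (sizes P (insert a G))"
  proof -
    have "?d = ?g(y := Suc (?g y))" using y(1) by auto
    then have "weight P ?d = weight P ?g + card P * Suc (card P) ^ ?g y"
      using weight_upd[OF dec(2) ab(6), of ?g] by simp
    moreover have "weight P (sizes P (insert a G)) = weight P ?g + card P * Suc (card P) ^ ?g x"
      unfolding sa by (rule weight_upd[OF dec(2) ab(5)])
    moreover have "?g y < ?g x" using y ab(7) by simp
    moreover have "card P > 0" using dec(2) ab(5) by (auto simp: card_gt_0_iff)
    ultimately show ?thesis by (simp add: power_strict_increasing_iff)
  qed
  ultimately show False using key_less_weight by (meson leD)
qed

text \<open>Suppose a set \<open>B\<close> with the enlarged vector is beaten by an isomorphic
  \<open>B''\<close>. By \<open>optimal_separates\<close>, the isomorphism sends no points of a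
  block in the layer and of another block into a common block. Removing one point per block of the
  layer from \<open>B\<close>, and its image from \<open>B''\<close>, restores the old vector and by
  \<open>key_remove_layer\<close> keeps the strict inequality, against the optimality of
  \<open>A0\<close>.\<close>

lemma optimal_repeat_layer:
  assumes dec: "monomorphic_decomposition R P" "finite P"
    and opt: "optimal R P A0" and t: "t > 0" "\<And>x. x \<in> P \<Longrightarrow> finite x \<Longrightarrow> card x < t"
  shows "\<exists>B. optimal R P B \<and> sizes P B = repeat_layer t (sizes P A0)"
proof -
  let ?d = "sizes P A0" and ?e = "repeat_layer t (sizes P A0)"
  have part: "disjoint P" "\<Union>P = dom_of R"
    using dec(1) by (auto simp: monomorphic_decomposition_def partition_on_def)
  have A0: "finite A0" "A0 \<subseteq> dom_of R" using opt by (simp_all add: optimal_def)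
  define S where "S = {x \<in> P. t \<le> ?d x}"
  have e: "?e x = (if x \<in> S then Suc (?d x) else ?d x)" for x
    using t(1) by (auto simp: S_def repeat_layer_def sizes_def)
  \<comment> \<open>Finite blocks stay below \<open>t\<close> and keep their sizes; only infinite
    blocks must supply a further point.\<close>
  have "\<exists>B\<subseteq>UNIV. finite B \<and> B \<subseteq> \<Union>P \<and> sizes P B = ?e"
  proof (rule ex_sizes[OF dec(2) part(1)])
    show "?e \<in> vecs P" using e by (auto simp: S_def sizes_def)
    fix x assume x: "x \<in> P" "finite (UNIV \<inter> x)"
    then have "?d x \<le> card x" by (auto simp: sizes_def intro: card_mono)
    moreover have "?d x < t" using calculation t(2)[of x] x by simp
    ultimately show "?e x \<le> card (UNIV \<inter> x)" by (simp add: repeat_layer_def)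
  qed
  then obtain B where B: "finite B" "B \<subseteq> dom_of R" "sizes P B = ?e"
    unfolding part(2) by (elim exE conjE) (rule that)
  have "optimal R P B"
  proof (rule ccontr)
    assume "\<not> optimal R P B"
    then obtain B'' where B'': "finite B''" "B'' \<subseteq> dom_of R" "induced_iso R B B''"
      and less: "key P (sizes P B) < key P (sizes P B'')"
      using B unfolding optimal_def by (meson not_le_imp_less)
    obtain f where f: "iso_map R f B B''" using B''(3) iso_iff by blast
    then have bij: "bij_betw f B B''" by (simp add: iso_map_def)
    have inj: "inj_on f B" using bij by (rule bij_betw_imp_inj_on)
    have le: "?d \<le> sizes P B" unfolding B(3) by (simp add: le_fun_def repeat_layer_def)
    \<comment> \<open>\<open>optimal_separates\<close> moves a point into the fuller of the two
      blocks. If that is \<open>y\<close>, it too has been enlarged, since \<open>?d y\<close>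
      exceeds \<open>t\<close>.\<close>
    have separated: "x = y" if "a \<in> B" "b \<in> B" "a \<in> x" "b \<in> y" "x \<in> S" "y \<in> P"
      "f a \<in> z" "f b \<in> z" "z \<in> P" for a b x y z
    proof (rule ccontr)
      assume ne: "x \<noteq> y"
      have x: "x \<in> P" "t \<le> ?d x" using that(5) by (auto simp: S_def)
      have "0 < sizes P B y" using that(2,4,6) B(1) by (auto simp: sizes_def card_gt_0_iff)
      then have y: "0 < ?d y" unfolding B(3) using t(1) by (auto simp: repeat_layer_def split: if_splits)
      show False
      proof (cases "?d y \<le> ?d x")
        case True
        show False
          by (rule optimal_separates[OF dec opt f B(1,2) B''(1,2) that(1-4) x(1) that(6) ne that(7-9) le _ y True])
            (use x in \<open>simp add: B(3) repeat_layer_def\<close>)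
      next
        case False
        show False
          by (rule optimal_separates[OF dec opt f B(1,2) B''(1,2) that(2,1,4,3,6) x(1) ne[symmetric] that(8,7,9) le])
            (use x False t(1) in \<open>simp_all add: B(3) repeat_layer_def\<close>)
      qed
    qed
    have "\<exists>a. a \<in> B \<inter> x" if "x \<in> S" for x
    proof -
      have "card (B \<inter> x) = ?e x" using that B(3) by (metis (no_types, lifting) S_def mem_Collect_eq sizes_def)
      then have "B \<inter> x \<noteq> {}" using e[of x] that by auto
      then show ?thesis by blast
    qed
    then obtain a where a: "\<And>x. x \<in> S \<Longrightarrow> a x \<in> B \<inter> x" by metis
    have "\<exists>z. z \<in> P \<and> f (a x) \<in> z" if "x \<in> S" for x
      using a[OF that] bij_betw_imp_surj_on[OF bij] B''(2) part(2) by blast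
    \<comment> \<open>\<open>\<tau> x\<close> is the block receiving the chosen point of
      \<open>x\<close>. Separation makes \<open>\<tau>\<close> injective and forces all points of
      \<open>B''\<close> in \<open>\<tau> x\<close> to come from \<open>x\<close>.\<close>
    then obtain \<tau> where \<tau>: "\<And>x. x \<in> S \<Longrightarrow> \<tau> x \<in> P \<and> f (a x) \<in> \<tau> x" by metis
    have SP: "S \<subseteq> P" by (auto simp: S_def)
    have inj_\<tau>: "inj_on \<tau> S"
    proof (rule inj_onI)
      fix x y assume "x \<in> S" "y \<in> S" "\<tau> x = \<tau> y"
      then show "x = y" using separated[of "a x" "a y" x y "\<tau> x"] a \<tau> SP by (metis IntE subsetD)
    qed
    have sub: "B'' \<inter> \<tau> x \<subseteq> f ` (B \<inter> x)" if x: "x \<in> S" for x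
    proof
      fix c assume c: "c \<in> B'' \<inter> \<tau> x"
      then obtain b where b: "b \<in> B" "c = f b" using bij_betw_imp_surj_on[OF bij] by blast
      then obtain y where y: "y \<in> P" "b \<in> y" using B(2) part(2) by blast
      have "x = y" using separated[of "a x" b x y "\<tau> x"] a[OF x] \<tau>[OF x] b c y x by blast
      then show "c \<in> f ` (B \<inter> x)" using b y by blast
    qed
    let ?A = "B - a ` S"
    have a_only: "a x \<in> y \<longleftrightarrow> x = y" if "x \<in> S" "y \<in> P" for x y
      using a[OF that(1)] disjointD[OF part(1) that(2), of x] that SP by blast
    have fa_only: "f (a x) \<in> y \<longleftrightarrow> \<tau> x = y" if "x \<in> S" "y \<in> P" for x y
      using \<tau>[OF that(1)] disjointD[OF part(1) that(2), of "\<tau> x"] by blast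
    have sA: "sizes P ?A = (\<lambda>x. if x \<in> S then sizes P B x - 1 else sizes P B x)"
    proof
      fix x
      have "?A \<inter> x = (if x \<in> S then B \<inter> x - {a x} else B \<inter> x)" if "x \<in> P"
        using a_only[OF _ that] by auto
      then show "sizes P ?A x = (if x \<in> S then sizes P B x - 1 else sizes P B x)"
        using a[of x] B(1) SP by (auto simp: sizes_def)
    qed
    have fA: "f ` ?A = B'' - (\<lambda>x. f (a x)) ` S"
      using inj_on_image_set_diff[OF inj, of B "a ` S"] a bij_betw_imp_surj_on[OF bij]
      by (auto simp: image_image)
    have sfA: "sizes P (f ` ?A) = (\<lambda>y. if y \<in> \<tau> ` S then sizes P B'' y - 1 else sizes P B'' y)"
    proof
      fix y
      show "sizes P (f ` ?A) y = (if y \<in> \<tau> ` S then sizes P B'' y - 1 else sizes P B'' y)"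
      proof (cases "y \<in> \<tau> ` S")
        case True
        then obtain x where x: "x \<in> S" "y = \<tau> x" by blast
        have "x' = x" if "x' \<in> S" "f (a x') \<in> y" for x'
        proof -
          have "y \<in> P" using \<tau>[OF x(1)] x(2) by simp
          then have "\<tau> x' = \<tau> x" using fa_only[OF that(1)] that(2) x(2) by blast
          then show ?thesis using inj_\<tau> that(1) x(1) by (auto dest: inj_onD)
        qed
        then have "f ` ?A \<inter> y = B'' \<inter> y - {f (a x)}"
          unfolding fA using x(1) by blast
        moreover have "f (a x) \<in> B'' \<inter> y"
          using a[OF x(1)] \<tau>[OF x(1)] x(2) bij_betw_imp_surj_on[OF bij] by blast
        ultimately show ?thesis using True B''(1) \<tau>[OF x(1)] x(2) by (simp add: sizes_def)
      next
        case False
        then have "f ` ?A \<inter> y = B'' \<inter> y" if "y \<in> P"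
          unfolding fA using fa_only[OF _ that] by blast
        then show ?thesis using False by (simp add: sizes_def)
      qed
    qed
    have "key P (\<lambda>x. if x \<in> S then sizes P B x - 1 else sizes P B x)
        < key P (\<lambda>y. if y \<in> \<tau> ` S then sizes P B'' y - 1 else sizes P B'' y)"
    proof (rule key_remove_layer[OF dec(2) SP inj_\<tau> _ t(1) _ _ _ less])
      show "\<tau> ` S \<subseteq> P" using \<tau> by blast
      show "t < sizes P B x" if "x \<in> S" for x using that unfolding B(3) e by (simp add: S_def)
      show "sizes P B x < t" if "x \<in> P - S" for x using that unfolding B(3) e by (auto simp: S_def)
      fix x assume x: "x \<in> S"
      have "f (a x) \<in> B'' \<inter> \<tau> x" using a[OF x] \<tau>[OF x] bij_betw_imp_surj_on[OF bij] by blast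
      then have "0 < card (B'' \<inter> \<tau> x)" using B''(1) by (auto simp: card_gt_0_iff)
      moreover have "card (B'' \<inter> \<tau> x) \<le> card (B \<inter> x)"
        using surj_card_le[OF _ sub[OF x]] B(1) by simp
      ultimately show "0 < sizes P B'' (\<tau> x) \<and> sizes P B'' (\<tau> x) \<le> sizes P B x"
        using \<tau>[OF x] x SP by (auto simp: sizes_def)
    qed
    then have "key P (sizes P ?A) < key P (sizes P (f ` ?A))" by (simp only: sA sfA)
    moreover have "sizes P ?A = ?d" unfolding sA B(3) using e by (simp add: fun_eq_iff)
    then have "optimal R P ?A"
      using B(1,2) by (intro optimal_of_sizes_eq[OF dec opt]) auto
    moreover have "induced_iso R ?A (f ` ?A)" by (rule iso_image[OF f]) blast
    moreover have "finite (f ` ?A)" using B(1) by simp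
    moreover have "f ` ?A \<subseteq> dom_of R" using B''(2) unfolding fA by blast
    ultimately show False unfolding optimal_def by (meson leD)
  qed
  then show ?thesis using B(3) by blast
qed

section \<open>Optimal vectors count isomorphism classes\<close>

text \<open>Infinitely many sets may be isomorphic to \<open>A\<close>, but their sizes are bounded
  by \<open>card A\<close>, so only finitely many keys compete.\<close>

lemma ex_optimal:
  assumes dec: "monomorphic_decomposition R P" "finite P" and A: "finite A" "A \<subseteq> dom_of R"
  shows "\<exists>B. optimal R P B \<and> induced_iso R A B"
proof -
  let ?S = "{B. finite B \<and> B \<subseteq> dom_of R \<and> induced_iso R A B}"
  have "(\<lambda>B. key P (sizes P B)) ` ?S \<subseteq> key P ` {d. \<forall>x. (x \<in> P \<longrightarrow> d x \<in> {..card A}) \<and> (x \<notin> P \<longrightarrow> d x = 0)}"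
  proof (clarify, rule imageI, clarify)
    fix B x assume B: "finite B" "induced_iso R A B"
    have "card (B \<inter> x) \<le> card B" using B(1) by (intro card_mono) auto
    then show "(x \<in> P \<longrightarrow> sizes P B x \<in> {..card A}) \<and> (x \<notin> P \<longrightarrow> sizes P B x = 0)"
      using iso_card[OF B(2)] by (simp add: sizes_def)
  qed
  moreover have "finite {d. \<forall>x. (x \<in> P \<longrightarrow> d x \<in> {..card A}) \<and> (x \<notin> P \<longrightarrow> d x = 0)}"
    using dec(2) by (intro finite_set_of_finite_funs) auto
  ultimately have fin: "finite ((\<lambda>B. key P (sizes P B)) ` ?S)"
    by (meson finite_imageI finite_subset)
  have "A \<in> ?S" using A iso_refl by blast
  then have "Max ((\<lambda>B. key P (sizes P B)) ` ?S) \<in> (\<lambda>B. key P (sizes P B)) ` ?S"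
    using fin by (intro Max_in) auto
  then obtain B where B: "B \<in> ?S" "key P (sizes P B) = Max ((\<lambda>B. key P (sizes P B)) ` ?S)" by auto
  have "key P (sizes P B') \<le> key P (sizes P B)" if "finite B'" "B' \<subseteq> dom_of R" "induced_iso R B B'" for B'
  proof -
    have "B' \<in> ?S" using that B(1) isomorphic_trans by blast
    then show ?thesis unfolding B(2) using fin by (intro Max_ge) auto
  qed
  then have "optimal R P B" using B(1) by (simp add: optimal_def)
  then show ?thesis using B(1) by blast
qed

text \<open>Each of the two keys bounds the other, and the key determines the vector.\<close>

lemma sizes_eq_of_optimal_iso:
  assumes "monomorphic_decomposition R P" "finite P" "optimal R P A" "optimal R P B" "induced_iso R A B"
  shows "sizes P A = sizes P B"
proof (rule key_inj[OF assms(2)])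
  show "key P (sizes P A) = key P (sizes P B)"
    using assms(3-5) isomorphic_sym unfolding optimal_def by (meson order_antisym)
qed (simp_all add: sizes_def)

lemma card_image_eq_of_kernel_eq:
  assumes "\<And>a b. a \<in> A \<Longrightarrow> b \<in> A \<Longrightarrow> f a = f b \<longleftrightarrow> g a = g b"
  shows "card (f ` A) = card (g ` A)"
proof -
  have "bij_betw (\<lambda>y. g (inv_into A f y)) (f ` A) (g ` A)"
    unfolding bij_betw_def
  proof
    have eq: "g (inv_into A f (f a)) = g a" if "a \<in> A" for a
      using assms[of "inv_into A f (f a)" a] that by (simp add: f_inv_into_f inv_into_into)
    show "inj_on (\<lambda>y. g (inv_into A f y)) (f ` A)"
      by (rule inj_onI) (use eq assms in auto)
    show "(\<lambda>y. g (inv_into A f y)) ` f ` A = g ` A"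
      using eq by (force simp: image_image)
  qed
  then show ?thesis by (rule bij_betw_same_card)
qed

text \<open>Every class contains an optimal set, and optimal sets are isomorphic exactly when their
  size vectors agree.\<close>

lemma profile_eq:
  assumes dec: "monomorphic_decomposition R P" "finite P"
  shows "profile R n = card {d \<in> sizes P ` {A. optimal R P A}. (\<Sum>x\<in>P. d x) = n}"
proof -
  have part: "disjoint P" "\<Union>P = dom_of R"
    using dec(1) by (auto simp: monomorphic_decomposition_def partition_on_def)
  let ?N = "nsubsets (dom_of R) n"
  let ?r = "{(A, B). A \<in> ?N \<and> B \<in> ?N \<and> induced_iso R A B}"
  let ?O = "{A \<in> ?N. optimal R P A}"
  have "{d \<in> sizes P ` {A. optimal R P A}. (\<Sum>x\<in>P. d x) = n} = sizes P ` ?O"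
    using sum_sizes[OF dec(2) part(1)] part(2) by (auto simp: nsubsets_def optimal_def)
  moreover have "card (sizes P ` ?O) = card ((\<lambda>A. ?r `` {A}) ` ?O)"
  proof (rule card_image_eq_of_kernel_eq)
    fix A B assume A: "A \<in> ?O" and B: "B \<in> ?O"
    have "sizes P A = sizes P B \<longleftrightarrow> induced_iso R A B"
      using sizes_eq_of_optimal_iso[OF dec] iso_of_sizes_eq[OF dec] A B by (auto simp: optimal_def)
    moreover have "induced_iso R A B \<longleftrightarrow> ?r `` {A} = ?r `` {B}"
    proof
      assume "induced_iso R A B"
      then have "induced_iso R A C \<longleftrightarrow> induced_iso R B C" for C using isomorphic_sym isomorphic_trans by blast
      then show "?r `` {A} = ?r `` {B}" using A B by auto
    next
      assume "?r `` {A} = ?r `` {B}"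
      moreover have "B \<in> ?r `` {B}" using B iso_refl by blast
      ultimately show "induced_iso R A B" by blast
    qed
    ultimately show "sizes P A = sizes P B \<longleftrightarrow> ?r `` {A} = ?r `` {B}" by blast
  qed
  moreover have "(\<lambda>A. ?r `` {A}) ` ?O = iso_classes R n"
  proof (intro equalityI subsetI)
    fix K assume "K \<in> (\<lambda>A. ?r `` {A}) ` ?O"
    then obtain A where A: "A \<in> ?N" "K = ?r `` {A}" by blast
    show "K \<in> iso_classes R n" unfolding iso_classes_def A(2) by (rule quotientI) (rule A(1))
  next
    fix K assume "K \<in> iso_classes R n"
    then obtain A where A: "A \<in> ?N" "K = ?r `` {A}" unfolding iso_classes_def by (auto elim: quotientE)
    then obtain B where B: "optimal R P B" "induced_iso R A B"
      using ex_optimal[OF dec] by (auto simp: nsubsets_def)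
    have "B \<in> ?N" using A(1) B iso_card[OF B(2)] by (simp add: nsubsets_def optimal_def)
    have "induced_iso R A C \<longleftrightarrow> induced_iso R B C" for C using B(2) isomorphic_sym isomorphic_trans by blast
    then have "K = ?r `` {B}" using A \<open>B \<in> ?N\<close> by auto
    then show "K \<in> (\<lambda>A. ?r `` {A}) ` ?O" using B(1) \<open>B \<in> ?N\<close> by blast
  qed
  ultimately show ?thesis by (simp only: profile_def)
qed

section \<open>Rationality of the profile series\<close>

lemma generating_series_profile:
  assumes dec: "monomorphic_decomposition R P" "finite P" and k: "card {x \<in> P. infinite x} = k"
  shows "generating_series (profile R) * (\<Prod>i=1..k. 1 - fps_X ^ i) \<in> range fps_of_poly"
proof -
  let ?B = "sizes P ` {A. optimal R P A}" and ?I = "{x \<in> P. infinite x}"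
  \<comment> \<open>As \<open>card\<close> is 0 on infinite blocks, the sum is finite and bounds the
    size of every finite block.\<close>
  define T where "T = Suc (\<Sum>x\<in>P. card x)"
  have T: "card x < T" if "x \<in> P" for x
    using member_le_sum[OF that _ dec(2), of card] by (simp add: T_def)
  have "gf (\<lambda>d. \<Sum>x\<in>P. d x) ?B * (\<Prod>i=1..card ?I. 1 - fps_X ^ i) \<in> range fps_of_poly"
  proof (rule gf_layer_closed[OF dec(2)])
    show "?I \<subseteq> P" by blast
    show "0 < T" by (simp add: T_def)
    show "?B \<subseteq> vecs P" by (auto simp: sizes_def)
    fix d assume "d \<in> ?B"
    then obtain A where A: "optimal R P A" "d = sizes P A" by blast
    show "{x. T \<le> d x} \<subseteq> ?I"
    proof
      fix x assume "x \<in> {x. T \<le> d x}"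
      then have x: "T \<le> d x" by simp
      then have "x \<in> P" by (cases "x \<in> P") (simp_all add: A(2) sizes_def T_def)
      moreover have "d x \<le> card x" if "finite x"
        unfolding A(2) using that by (auto simp: sizes_def intro: card_mono)
      ultimately show "x \<in> ?I" using x T[of x] by fastforce
    qed
    fix t assume "T \<le> t"
    then have "t > 0" "\<And>x. x \<in> P \<Longrightarrow> finite x \<Longrightarrow> card x < t" using T by (fastforce simp: T_def)+
    from optimal_repeat_layer[OF dec A(1) this] show "repeat_layer t d \<in> ?B"
      unfolding A(2) by (metis imageI mem_Collect_eq)
  qed
  moreover have "gf (\<lambda>d. \<Sum>x\<in>P. d x) ?B = generating_series (profile R)"
    unfolding gf_def generating_series_def profile_eq[OF dec] ..
  ultimately show ?thesis unfolding k by simp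
qed

theorem theorem3:
  fixes R :: "('a, 'i) rel_structure" and \<P> :: "'a set set" and k :: nat
  assumes "rel_structure R"
    and "infinite (dom_of R)"
    and "monomorphic_decomposition R \<P>"
    and "finite \<P>"
    and "card {B \<in> \<P>. infinite B} = k"
  shows "(\<exists>P :: rat poly.
            generating_series (profile R) = fps_of_poly P / (\<Prod>i=1..k. 1 - fps_X ^ i)) \<and>
         eventually_quasi_polynomial (profile R) k"
proof
  let ?D = "\<Prod>i=1..k. 1 - fps_X ^ i :: rat fps"
  have rational: "generating_series (profile R) * ?D \<in> range fps_of_poly"
    by (rule generating_series_profile[OF assms(3-5)])
  then obtain P where P: "generating_series (profile R) * ?D = fps_of_poly P" by blast
  \<comment> \<open>Since \<open>i \<ge> 1\<close>, each factor has constant term 1; the denominator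
    is thus nonzero and cancels.\<close>
  have "1 - fps_X ^ i \<noteq> (0 :: rat fps)" if "i \<in> {1..k}" for i
  proof
    assume "1 - fps_X ^ i = (0 :: rat fps)"
    then have "(1 - fps_X ^ i) $ 0 = (0 :: rat fps) $ 0" by (rule arg_cong)
    with that show False by (simp add: fps_X_power_nth)
  qed
  then have "?D \<noteq> 0" by (simp only: prod_zero_iff finite_atLeastAtMost) blast
  then have "generating_series (profile R) = fps_of_poly P / ?D"
    unfolding P[symmetric] by (rule nonzero_mult_div_cancel_right[symmetric])
  then show "\<exists>P :: rat poly. generating_series (profile R) = fps_of_poly P / ?D" by blast
  have union: "\<Union>\<P> = dom_of R"
    using assms(3) by (auto simp: monomorphic_decomposition_def partition_on_def)
  \<comment> \<open>Finitely many finite blocks cannot cover an infinite domain, so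
    \<open>k > 0\<close>, as the degree bound \<open>k - 1\<close> requires.\<close>
  have "{B \<in> \<P>. infinite B} \<noteq> {}"
  proof
    assume "{B \<in> \<P>. infinite B} = {}"
    then have "finite (\<Union>\<P>)" by (intro finite_Union[OF assms(4)]) blast
    with assms(2) union show False by simp
  qed
  then have "k > 0" using assms(4,5) by (auto simp: card_gt_0_iff)
  with rational show "eventually_quasi_polynomial (profile R) k"
    by (rule quasi_polynomial_of_rational)
qed

end
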